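(* Let $\mathcal{G}$ be a $d$-regular Borel pmp graph on a standard probability space $(X,\mu)$. Then for any $\mu$-measurable $\mathcal{G}$-independent set $S\subseteq X$, $$\mu(S)\le\frac{-m(T_{\mathcal{G}})}{d-m(T_{\mathcal{G}})}=1-\frac{d}{M(L_{\mathcal{G}})}.$$ In particular, $i_\mu(\mathcal{G})\le\frac{-m(T_{\mathcal{G}})}{d-m(T_{\mathcal{G}})}$.
   Context: A Borel graph on $X$ is a simple undirected graph with Borel edge set; $d$-regular means all degrees equal $d$ (up to null sets). pmp: every partial Borel bijection of $X$ whose graph is contained in the connectedness relation of $\mathcal{G}$ preserves $\mu$. $T_{\mathcal{G}}f(x)=\sum_{y\sim x}f(y)$ and $L_{\mathcal{G}}f(x)=\deg(x)f(x)-\sum_{y\sim x}f(y)$ on $L^2(X,\mu)$. For a bounded self-adjoint $T$, $M(T)=\sup_{f\ne0}\langle Tf,f\rangle/\langle f,f\rangle$, $m(T)=\inf_{f\ne0}\langle Tf,f\rangle/\langle f,f\rangle$. A set is $\mathcal{G}$-independent if no two of its points are adjacent; $i_\mu(\mathcal{G})=\sup\{\mu(A): A \text{ measurable and } \mathcal{G}\text{-independent}\}$. *)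

theory Defs
  imports "HOL-Analysis.Analysis" "HOL-Probability.Probability"
begin

definition simple_graph :: "('a \<Rightarrow> 'a \<Rightarrow> bool) \<Rightarrow> bool" where
  "simple_graph E \<longleftrightarrow> (\<forall>x y. E x y \<longrightarrow> E y x) \<and> (\<forall>x. \<not> E x x)"

definition borel_graph :: "('a::topological_space \<Rightarrow> 'a \<Rightarrow> bool) \<Rightarrow> bool" where
  "borel_graph E \<longleftrightarrow> simple_graph E \<and> {(x, y). E x y} \<in> sets (borel \<Otimes>\<^sub>M borel)"

definition regular_graph :: "'a measure \<Rightarrow> ('a \<Rightarrow> 'a \<Rightarrow> bool) \<Rightarrow> nat \<Rightarrow> bool" where
  "regular_graph M E d \<longleftrightarrow> (AE x in M. finite {y. E x y} \<and> card {y. E x y} = d)"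

definition conn_rel :: "('a \<Rightarrow> 'a \<Rightarrow> bool) \<Rightarrow> ('a \<times> 'a) set" where
  "conn_rel E = {(x, y). E x y}\<^sup>*"

definition partial_borel_bij :: "('a::topological_space \<Rightarrow> 'a) \<Rightarrow> 'a set \<Rightarrow> bool" where
  "partial_borel_bij f A \<longleftrightarrow> A \<in> sets borel \<and> inj_on f A \<and>
     f \<in> borel_measurable (restrict_space borel A) \<and> f ` A \<in> sets borel"

definition pmp_graph :: "'a::topological_space measure \<Rightarrow> ('a \<Rightarrow> 'a \<Rightarrow> bool) \<Rightarrow> bool" where
  "pmp_graph M E \<longleftrightarrow> (\<forall>f A. partial_borel_bij f A \<and> (\<forall>x\<in>A. (x, f x) \<in> conn_rel E)
       \<longrightarrow> measure M (f ` A) = measure M A)"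

definition adj_op :: "('a \<Rightarrow> 'a \<Rightarrow> bool) \<Rightarrow> ('a \<Rightarrow> real) \<Rightarrow> 'a \<Rightarrow> real" where
  "adj_op E f x = (\<Sum>y\<in>{y. E x y}. f y)"

definition lap_op :: "('a \<Rightarrow> 'a \<Rightarrow> bool) \<Rightarrow> ('a \<Rightarrow> real) \<Rightarrow> 'a \<Rightarrow> real" where
  "lap_op E f x = real (card {y. E x y}) * f x - (\<Sum>y\<in>{y. E x y}. f y)"

text \<open>Nonzero elements of L^2(X, mu) (represented by Borel square-integrable functions
  of positive norm) and the Rayleigh quotients of an operator.\<close>
definition rayleigh_quotients ::
  "'a::topological_space measure \<Rightarrow> (('a \<Rightarrow> real) \<Rightarrow> 'a \<Rightarrow> real) \<Rightarrow> real set" where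
  "rayleigh_quotients M T =
     {(\<integral>x. T f x * f x \<partial>M) / (\<integral>x. (f x)\<^sup>2 \<partial>M) | f.
        f \<in> borel_measurable M \<and> integrable M (\<lambda>x. (f x)\<^sup>2) \<and> (\<integral>x. (f x)\<^sup>2 \<partial>M) \<noteq> 0}"

definition M_op :: "'a::topological_space measure \<Rightarrow> (('a \<Rightarrow> real) \<Rightarrow> 'a \<Rightarrow> real) \<Rightarrow> real" where
  "M_op M T = Sup (rayleigh_quotients M T)"

definition m_op :: "'a::topological_space measure \<Rightarrow> (('a \<Rightarrow> real) \<Rightarrow> 'a \<Rightarrow> real) \<Rightarrow> real" where
  "m_op M T = Inf (rayleigh_quotients M T)"

definition independent_set :: "('a \<Rightarrow> 'a \<Rightarrow> bool) \<Rightarrow> 'a set \<Rightarrow> bool" where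
  "independent_set E S \<longleftrightarrow> (\<forall>x\<in>S. \<forall>y\<in>S. \<not> E x y)"

definition indep_number :: "'a measure \<Rightarrow> ('a \<Rightarrow> 'a \<Rightarrow> bool) \<Rightarrow> real" where
  "indep_number M E = Sup {measure (completion M) A | A. A \<in> sets (completion M) \<and> independent_set E A}"

end

theory Submission
  imports Defs
begin

text \<open>For an independent set S of measure s the centred indicator of S has squared norm s - s^2, and
  the form of the adjacency operator at it is - d s^2, because integrating the adjacency operator
  multiplies integrals by d. Comparing the two gives the bound, and s > 0 forces m < 0.

  The work lies in making this meaningful outside the conull set X of points of degree d. Almost every
  point of X has all its neighbours in X: a Borel map along edges from a set of positive measure into
  a null set would contradict the invariance of the measure. Borel selection from the finite
  neighbourhoods in X needs no general uniformization theorem: with the number of neighbours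
  fixed, both a condition on the neighbours and its negation are projections of Borel sets, and
  Lusin's separation theorem applies.\<close>

section \<open>Lusin's separation theorem\<close>

text \<open>Invariance is available only for injective maps with Borel image. Edges leaving
  \<open>X\<close> are the obstacle: a vertex outside \<open>X\<close> may have uncountably many
  neighbours, so a Borel map sending points of \<open>X\<close> to neighbours outside
  \<open>X\<close> need not be countable-to-one, and countably many injective pieces need not
  exhaust its domain. \<open>measure_into_null\<close> therefore works inside the fibres: points of
  one fibre are connected through their common image, and a fibre without atoms has room for two
  disjoint copies of most of the domain. Edges with both ends in \<open>X\<close> are easier: basic
  open sets isolate each end among the neighbours of the other, which gives a Borel map with an
  explicit Borel inverse.

  Negativity of the infimum of the Rayleigh quotients is needed twice: it keeps the denominator
  \<open>d - m\<close> positive, and it makes a stray quotient 0, coming from nonmeasurable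
  functions, harmless.\<close>

instance prod :: (polish_space, polish_space) polish_space ..

text \<open>The second factor is Baire space, \<open>discrete\<close> giving each digit the discrete
  topology. Over a Polish first factor such a set is a continuous image of a closed set in a Polish
  space, the form that \<open>borel_separated_images\<close> takes.\<close>

definition analytic :: "'a::topological_space set \<Rightarrow> bool" where
  "analytic A \<longleftrightarrow> (\<exists>F :: ('a \<times> (nat \<Rightarrow> nat discrete)) set. closed F \<and> A = fst ` F)"

lemma analytic_closed:
  assumes "closed A" shows "analytic A"
  unfolding analytic_def
proof (intro exI conjI)
  show "closed (A \<times> (UNIV :: (nat \<Rightarrow> nat discrete) set))"
    using assms by (intro closed_Times) auto
qed auto

text \<open>One digit sequence carries witnesses for all \<open>A n\<close> at once; witness
  \<open>n\<close> is read along \<open>prod_encode (n, k)\<close>.\<close>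

lemma analytic_INT:
  fixes A :: "nat \<Rightarrow> 'a::topological_space set"
  assumes "\<And>n. analytic (A n)" shows "analytic (\<Inter>n. A n)"
proof -
  obtain F :: "nat \<Rightarrow> ('a \<times> (nat \<Rightarrow> nat discrete)) set"
    where F: "\<And>n. closed (F n)" "\<And>n. A n = fst ` F n"
    using assms unfolding analytic_def by metis
  define h where "h n p = (fst p, \<lambda>k. snd p (prod_encode (n, k)))"
    for n and p :: "'a \<times> (nat \<Rightarrow> nat discrete)"
  have cont: "continuous_on UNIV (h n)" for n
    unfolding h_def by (intro continuous_intros continuous_on_coordinatewise_then_product
      continuous_on_product_then_coordinatewise[of _ "\<lambda>p. snd p"])
  define G where "G = (\<Inter>n. h n -` F n)"
  have "closed G"
    unfolding G_def by (intro closed_INT ballI closed_vimage F cont)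
  moreover have "(\<Inter>n. A n) = fst ` G"
  proof (intro equalityI subsetI)
    fix x assume "x \<in> (\<Inter>n. A n)"
    then have "\<forall>n. \<exists>w. (x, w) \<in> F n"
      using F(2) by force
    then obtain w where w: "\<And>n. (x, w n) \<in> F n" by metis
    have "(x, \<lambda>m. w (fst (prod_decode m)) (snd (prod_decode m))) \<in> G"
      by (auto simp: G_def h_def w)
    then show "x \<in> fst ` G" by force
  next
    fix x assume "x \<in> fst ` G"
    then obtain w where "(x, w) \<in> G" by auto
    then show "x \<in> (\<Inter>n. A n)"
      by (force simp: G_def h_def F(2))
  qed
  ultimately show ?thesis unfolding analytic_def by blast
qed

text \<open>Digit 0 names the index \<open>n\<close> and the shifted sequence is the witness. Fixing
  digit 0 is an open condition, so the implications that define \<open>G\<close> are closed.\<close>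

lemma analytic_UN:
  fixes A :: "nat \<Rightarrow> 'a::topological_space set"
  assumes "\<And>n. analytic (A n)" shows "analytic (\<Union>n. A n)"
proof -
  obtain F :: "nat \<Rightarrow> ('a \<times> (nat \<Rightarrow> nat discrete)) set"
    where F: "\<And>n. closed (F n)" "\<And>n. A n = fst ` F n"
    using assms unfolding analytic_def by metis
  define h where "h p = (fst p, \<lambda>k. snd p (Suc k))" for p :: "'a \<times> (nat \<Rightarrow> nat discrete)"
  have cont: "continuous_on UNIV h"
    unfolding h_def by (intro continuous_intros continuous_on_coordinatewise_then_product
      continuous_on_product_then_coordinatewise[of _ "\<lambda>p. snd p"])
  have op: "open {p :: 'a \<times> (nat \<Rightarrow> nat discrete). snd p 0 = discrete n}" for n
  proof -
    have "open ((\<lambda>p :: 'a \<times> (nat \<Rightarrow> nat discrete). snd p 0) -` {discrete n})"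
      by (intro open_vimage open_discrete continuous_intros
          continuous_on_product_then_coordinatewise[of _ "\<lambda>p. snd p"])
    then show ?thesis by (simp add: vimage_def)
  qed
  define G where "G = {p. \<forall>n. snd p 0 = discrete n \<longrightarrow> p \<in> h -` F n}"
  have "closed {p. p \<in> h -` F n}" for n
    using closed_vimage[OF F(1) cont] by (simp only: vimage_def mem_Collect_eq)
  then have "closed G"
    unfolding G_def by (intro closed_Collect_all closed_Collect_imp op)
  moreover have "(\<Union>n. A n) = fst ` G"
  proof (intro equalityI subsetI)
    fix x assume "x \<in> (\<Union>n. A n)"
    then obtain n w where w: "(x, w) \<in> F n" using F(2) by force
    have "(x, \<lambda>k. case k of 0 \<Rightarrow> discrete n | Suc k \<Rightarrow> w k) \<in> G"
      using w by (auto simp: G_def h_def discrete_inject)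
    then show "x \<in> fst ` G" by force
  next
    fix x assume "x \<in> fst ` G"
    then obtain w where w: "(x, w) \<in> G" by auto
    obtain n where "w 0 = discrete n" by (cases "w 0") auto
    with w show "x \<in> (\<Union>n. A n)"
      by (force simp: G_def h_def F(2))
  qed
  ultimately show ?thesis unfolding analytic_def by blast
qed

text \<open>An open set is a countable union of closed sets, cut out by the distance to its
  complement. The whole space is treated apart because \<open>infdist\<close> to the empty set is 0
  by convention.\<close>

lemma analytic_open:
  fixes A :: "'a::metric_space set"
  assumes "open A" shows "analytic A"
proof -
  consider "A = UNIV" | "- A \<noteq> {}" by auto
  then show ?thesis
  proof cases
    case 1
    then show ?thesis by (auto intro: analytic_closed)
  next
    case 2
    have "A = (\<Union>n. {x. 1 / real (Suc n) \<le> infdist x (- A)})"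
    proof (intro equalityI subsetI)
      fix x assume "x \<in> A"
      then have "infdist x (- A) > 0"
        using infdist_pos_not_in_closed[of "- A" x] assms 2 by auto
      then obtain n where "1 / real (Suc n) < infdist x (- A)" by (rule nat_approx_posE)
      then show "x \<in> (\<Union>n. {x. 1 / real (Suc n) \<le> infdist x (- A)})"
        by (blast intro: less_imp_le)
    next
      fix x assume "x \<in> (\<Union>n. {x. 1 / real (Suc n) \<le> infdist x (- A)})"
      then obtain n where "1 / real (Suc n) \<le> infdist x (- A)" by auto
      then have "infdist x (- A) > 0" by (rule less_le_trans[rotated]) simp
      then show "x \<in> A" using infdist_zero[of x "- A"] by (metis ComplI less_irrefl)
    qed
    moreover have "closed {x. 1 / real (Suc n) \<le> infdist x (- A)}" for n
      by (intro closed_Collect_le continuous_intros)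
    ultimately show ?thesis using analytic_UN analytic_closed by metis
  qed
qed

text \<open>Analytic sets are not closed under complements, so the induction carries each set
  together with its complement.\<close>

lemma borel_imp_analytic:
  fixes A :: "'a::metric_space set"
  assumes "A \<in> sets borel" shows "analytic A"
proof -
  have "A \<in> sigma_sets UNIV {S. open S}"
    using assms by (simp add: borel_def)
  then have "analytic A \<and> analytic (- A)"
  proof induction
    case (Basic a)
    then show ?case by (auto intro: analytic_open analytic_closed)
  next
    case Empty
    then show ?case by (auto intro: analytic_closed)
  next
    case (Compl a)
    then show ?case by (simp add: Compl_eq_Diff_UNIV[symmetric])
  next
    case (Union a)
    then show ?case by (auto intro!: analytic_UN analytic_INT)
  qed
  then show ?thesis ..
qed

section \<open>Separation of disjoint analytic sets by Borel sets\<close>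

definition borel_separated :: "'a::topological_space set \<Rightarrow> 'a set \<Rightarrow> bool" where
  "borel_separated A B \<longleftrightarrow> (\<exists>C\<in>sets borel. A \<subseteq> C \<and> B \<inter> C = {})"

text \<open>Used contrapositively: if two sets cut into countably many pieces cannot be separated,
  neither can some pair of pieces.\<close>

lemma borel_separated_UN:
  fixes A B :: "nat \<Rightarrow> 'a::topological_space set"
  assumes "\<And>n m. borel_separated (A n) (B m)"
  shows "borel_separated (\<Union>n. A n) (\<Union>m. B m)"
proof -
  obtain C where C: "\<And>n m. C n m \<in> sets borel" "\<And>n m. A n \<subseteq> C n m" "\<And>n m. B m \<inter> C n m = {}"
    using assms unfolding borel_separated_def by metis
  show ?thesis unfolding borel_separated_def
  proof (intro bexI conjI)
    show "(\<Union>n. \<Inter>m. C n m) \<in> sets borel" using C(1) by auto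
    show "(\<Union>n. A n) \<subseteq> (\<Union>n. \<Inter>m. C n m)" using C(2) by auto
    show "(\<Union>m. B m) \<inter> (\<Union>n. \<Inter>m. C n m) = {}" using C(3) by auto
  qed
qed

lemma cball_countable_cover:
  fixes e :: real
  assumes "e > 0"
  obtains c :: "nat \<Rightarrow> 'p::{metric_space, second_countable_topology}"
  where "(\<Union>n. cball (c n) e) = UNIV"
proof -
  obtain D :: "'p set" where D: "countable D" "\<And>U. open U \<Longrightarrow> U \<noteq> {} \<Longrightarrow> \<exists>d\<in>D. d \<in> U"
    using countable_dense_setE by blast
  have "D \<noteq> {}" using D(2)[of UNIV] by auto
  have "x \<in> (\<Union>n. cball (from_nat_into D n) e)" for x
  proof -
    obtain d where d: "d \<in> D" "d \<in> ball x e" using D(2)[of "ball x e"] assms by auto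
    obtain n where "from_nat_into D n = d" using from_nat_into_surj[OF D(1) d(1)] ..
    then have "x \<in> cball (from_nat_into D n) e" using d(2) by (simp add: dist_commute)
    then show ?thesis by blast
  qed
  then show thesis using that[of "from_nat_into D"] by blast
qed

text \<open>If the two images could not be separated, one could shrink both closed sets to points
  without losing inseparability.\<close>

theorem borel_separated_images:
  fixes f :: "'p::polish_space \<Rightarrow> 'a::t2_space" and g :: "'q::polish_space \<Rightarrow> 'a"
  assumes F: "closed F" and G: "closed G" and f: "continuous_on UNIV f" and g: "continuous_on UNIV g"
    and disj: "f ` F \<inter> g ` G = {}"
  shows "borel_separated (f ` F) (g ` G)"
proof (rule ccontr)
  assume notsep: "\<not> ?thesis"
  define bad where "bad p \<longleftrightarrow> closed (fst p) \<and> closed (snd p) \<and> fst p \<subseteq> F \<and> snd p \<subseteq> G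
    \<and> \<not> borel_separated (f ` fst p) (g ` snd p)" for p
  have step: "\<exists>q. bad q \<and> fst q \<subseteq> fst p \<and> snd q \<subseteq> snd p
      \<and> (\<exists>c. fst q \<subseteq> cball c ((1/2)^n)) \<and> (\<exists>c. snd q \<subseteq> cball c ((1/2)^n))"
    if p: "bad p" for p and n :: nat
  proof -
    obtain c :: "nat \<Rightarrow> 'p" where c: "(\<Union>i. cball (c i) ((1/2)^n)) = UNIV"
      using cball_countable_cover[of "(1/2)^n"] by auto
    obtain c' :: "nat \<Rightarrow> 'q" where c': "(\<Union>i. cball (c' i) ((1/2)^n)) = UNIV"
      using cball_countable_cover[of "(1/2)^n"] by auto
    let ?P = "\<lambda>i. fst p \<inter> cball (c i) ((1/2)^n)" and ?Q = "\<lambda>i. snd p \<inter> cball (c' i) ((1/2)^n)"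
    have "fst p = (\<Union>i. ?P i)" "snd p = (\<Union>i. ?Q i)"
      by (simp_all only: Int_UN_distrib[symmetric] c c' Int_UNIV_right)
    then have "f ` fst p = (\<Union>i. f ` ?P i)" "g ` snd p = (\<Union>i. g ` ?Q i)"
      by (metis image_UN)+
    then obtain i j where "\<not> borel_separated (f ` ?P i) (g ` ?Q j)"
      using p borel_separated_UN[of "\<lambda>i. f ` ?P i" "\<lambda>i. g ` ?Q i"] unfolding bad_def by metis
    with p show ?thesis
      by (intro exI[of _ "(?P i, ?Q j)"]) (auto simp: bad_def)
  qed
  have bad0: "bad (F, G)" using F G notsep by (simp add: bad_def)
  obtain s where bad: "\<And>n. bad (s n)"
    and dec: "\<And>n. fst (s (Suc n)) \<subseteq> fst (s n)" "\<And>n. snd (s (Suc n)) \<subseteq> snd (s n)"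
    and small: "\<And>n. \<exists>c. fst (s (Suc n)) \<subseteq> cball c ((1/2)^n)"
               "\<And>n. \<exists>c. snd (s (Suc n)) \<subseteq> cball c ((1/2)^n)"
    using dependent_nat_choice[of "\<lambda>_. bad" "\<lambda>n p q. fst q \<subseteq> fst p \<and> snd q \<subseteq> snd p
      \<and> (\<exists>c. fst q \<subseteq> cball c ((1/2)^n)) \<and> (\<exists>c. snd q \<subseteq> cball c ((1/2)^n))"]
      bad0 step by metis
  have dia: "\<exists>n. \<forall>x\<in>h (s n). \<forall>y\<in>h (s n). dist x y < e"
    if h: "\<And>n. \<exists>c. h (s (Suc n)) \<subseteq> cball c ((1/2)^n)" and e: "e > 0"
    for h :: "_ \<Rightarrow> 'z::metric_space set" and e :: real
  proof -
    obtain n where n: "(1/2)^n < e / 2"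
      using real_arch_pow_inv[of "e/2" "1/2"] e by auto
    obtain c where c: "h (s (Suc n)) \<subseteq> cball c ((1/2)^n)" using h by blast
    have "dist x y < e" if "x \<in> h (s (Suc n))" "y \<in> h (s (Suc n))" for x y
    proof -
      have "dist c x \<le> (1/2)^n" "dist c y \<le> (1/2)^n" using c that by auto
      with n show ?thesis using dist_triangle3[of x y c] by linarith
    qed
    then show ?thesis by blast
  qed
  \<comment> \<open>An empty set is always separated from any other, by \<open>{}\<close> or by the
    whole space.\<close>
  have ne: "fst (s n) \<noteq> {}" "snd (s n) \<noteq> {}" for n
    using bad[of n] unfolding bad_def borel_separated_def by auto
  have mono: "fst (s n) \<subseteq> fst (s m)" "snd (s n) \<subseteq> snd (s m)" if "m \<le> n" for m n
    using lift_Suc_antimono_le[of "\<lambda>n. fst (s n)"] lift_Suc_antimono_le[of "\<lambda>n. snd (s n)"] dec that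
    by auto
  obtain a where a: "(\<Inter>n. fst (s n)) = {a}"
    using decreasing_closed_nest_sing[of "\<lambda>n. fst (s n)"] bad ne mono dia[of fst, OF small(1)]
    unfolding bad_def by (auto simp: image_def)
  obtain b where b: "(\<Inter>n. snd (s n)) = {b}"
    using decreasing_closed_nest_sing[of "\<lambda>n. snd (s n)"] bad ne mono dia[of snd, OF small(2)]
    unfolding bad_def by (auto simp: image_def)
  have "a \<in> F" "b \<in> G" using a b bad unfolding bad_def by blast+
  \<comment> \<open>By continuity \<open>U\<close> and \<open>V\<close> below contain the images of
    small enough pieces, and then \<open>U\<close> itself separates these, a contradiction.\<close>
  then have "f a \<noteq> g b" using disj by auto
  then obtain U V where UV: "open U" "open V" "f a \<in> U" "g b \<in> V" "U \<inter> V = {}"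
    using hausdorff by metis
  have shrink: "\<exists>n. h (s n) \<subseteq> W"
    if W: "open W" "z \<in> W" and z: "(\<Inter>n. h (s n)) = {z}"
      and h: "\<And>n. \<exists>c. h (s (Suc n)) \<subseteq> cball c ((1/2)^n)"
    for h :: "_ \<Rightarrow> 'z::metric_space set" and W z
  proof -
    obtain e where e: "e > 0" "ball z e \<subseteq> W" using openE[OF W] .
    obtain n where n: "\<forall>x\<in>h (s n). \<forall>y\<in>h (s n). dist x y < e"
      using dia[of h, OF h e(1)] by (rule exE)
    have "z \<in> (\<Inter>n. h (s n))" unfolding z by simp
    then have "z \<in> h (s n)" by (rule INT_D) simp
    with n have "h (s n) \<subseteq> ball z e" by (simp add: subset_iff)
    with e(2) have "h (s n) \<subseteq> W" by (rule order_trans[rotated])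
    then show ?thesis ..
  qed
  obtain n where n: "fst (s n) \<subseteq> f -` U"
    using shrink[of "f -` U" a fst, OF _ _ a small(1)] UV open_vimage[OF _ f] by auto
  obtain m where m: "snd (s m) \<subseteq> g -` V"
    using shrink[of "g -` V" b snd, OF _ _ b small(2)] UV open_vimage[OF _ g] by auto
  let ?k = "max n m"
  have "f ` fst (s ?k) \<subseteq> U" "g ` snd (s ?k) \<subseteq> V"
    using n m mono[of n ?k] mono[of m ?k] by auto
  then have "borel_separated (f ` fst (s ?k)) (g ` snd (s ?k))"
    unfolding borel_separated_def using UV by (intro bexI[of _ U]) auto
  then show False using bad[of ?k] unfolding bad_def by blast
qed

text \<open>The set and its complement in the projection are both projections of Borel sets, so a Borel
  set separates them.\<close>

theorem borel_descend:
  fixes Q :: "('a::polish_space \<times> 'w::polish_space) set"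
  assumes Q: "fst ` Q \<in> sets borel" "Q \<in> sets borel" and P: "{z \<in> Q. P (fst z)} \<in> sets borel"
  shows "{x \<in> fst ` Q. P x} \<in> sets borel"
proof -
  have notP: "{z \<in> Q. \<not> P (fst z)} \<in> sets borel"
  proof -
    have "{z \<in> Q. \<not> P (fst z)} = Q - {z \<in> Q. P (fst z)}" by blast
    then show ?thesis using Q(2) P by simp
  qed
  obtain F G :: "(('a \<times> 'w) \<times> (nat \<Rightarrow> nat discrete)) set"
    where F: "closed F" "{z \<in> Q. P (fst z)} = fst ` F"
      and G: "closed G" "{z \<in> Q. \<not> P (fst z)} = fst ` G"
    using borel_imp_analytic[OF P] borel_imp_analytic[OF notP] unfolding analytic_def by metis
  let ?f = "\<lambda>z :: ('a \<times> 'w) \<times> (nat \<Rightarrow> nat discrete). fst (fst z)"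
  have im: "?f ` F = {x \<in> fst ` Q. P x}" "?f ` G = {x \<in> fst ` Q. \<not> P x}"
    unfolding image_image[symmetric, of fst fst] F(2)[symmetric] G(2)[symmetric] by auto
  have "borel_separated (?f ` F) (?f ` G)"
    by (rule borel_separated_images[OF F(1) G(1)]) (auto intro!: continuous_intros simp: im)
  then obtain C where "C \<in> sets borel" "{x \<in> fst ` Q. P x} \<subseteq> C" "{x \<in> fst ` Q. \<not> P x} \<inter> C = {}"
    unfolding borel_separated_def im by blast
  then have "{x \<in> fst ` Q. P x} = fst ` Q \<inter> C" by auto
  then show ?thesis using Q(1) \<open>C \<in> sets borel\<close> by auto
qed

section \<open>Inner approximation of Borel functions\<close>

lemma finite_measure_inner_compact:
  fixes M :: "'a::polish_space measure"
  assumes "finite_measure M" and sets: "sets M = sets borel" and C: "C \<in> sets borel" and e: "e > 0"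
  obtains K where "compact K" "K \<subseteq> C" "measure M (C - K) \<le> e"
proof -
  interpret finite_measure M by fact
  have C': "C \<in> sets M" using C sets by simp
  have "\<exists>K. compact K \<and> K \<subseteq> C \<and> measure M C - e < measure M K"
  \<comment> \<open>In the first case the difference is negative and \<open>ennreal\<close> would
    truncate it to 0, which is not strictly below a null measure.\<close>
  proof (cases "measure M C < e")
    case True
    then show ?thesis by (intro exI[of _ "{}"]) auto
  next
    case False
    have "ennreal (measure M C - e) < emeasure M C"
      unfolding emeasure_eq_measure using e False by (intro ennreal_lessI) auto
    also have "emeasure M C = (SUP K \<in> {K. K \<subseteq> C \<and> compact K}. emeasure M K)"
      using C by (intro inner_regular[OF sets]) auto
    finally obtain K where K: "K \<subseteq> C" "compact K" "ennreal (measure M C - e) < emeasure M K"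
      by (auto simp: less_SUP_iff)
    then have "measure M C - e < measure M K"
      using False by (simp add: emeasure_eq_measure ennreal_less_iff)
    with K show ?thesis by blast
  qed
  then obtain K where K: "compact K" "K \<subseteq> C" "measure M C - e < measure M K" by blast
  moreover have "K \<in> sets M" using K sets by (simp add: borel_compact)
  ultimately show thesis using that[of K] C' by (simp add: finite_measure_Diff)
qed

text \<open>One enumerated basis serves three purposes: test sets in Lusin's theorem, binary digits
  of points, and neighbourhoods that isolate a single neighbour in the graph.\<close>

definition base :: "nat \<Rightarrow> 'a::second_countable_topology set" where
  "base = from_nat_into (SOME B. countable B \<and> topological_basis B)"

lemma topological_basis_base: "topological_basis (range base :: 'a::second_countable_topology set set)"
proof -
  define \<B> :: "'a set set" where "\<B> = (SOME B. countable B \<and> topological_basis B)"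
  have \<B>: "countable \<B>" "topological_basis \<B>"
    using someI_ex[OF ex_countable_basis] unfolding \<B>_def by auto
  have "\<B> \<noteq> {}" using topological_basisE[OF \<B>(2) open_UNIV UNIV_I] by blast
  then have "range base = \<B>" using range_from_nat_into \<B>(1) by (simp add: base_def \<B>_def[symmetric])
  with \<B>(2) show ?thesis by simp
qed

lemma open_base: "open (base n)"
  using topological_basis_open[OF topological_basis_base] by blast

lemma baseE:
  assumes "open W" "x \<in> W" obtains n where "x \<in> base n" "base n \<subseteq> W"
  using topological_basisE[OF topological_basis_base assms] by blast

lemma base_borel[measurable]: "base n \<in> sets borel"
  by (rule borel_open[OF open_base])

text \<open>Preimages of basic open sets and of their complements are approximated from
  inside by compact sets, and these become relatively clopen in the intersection.\<close>

theorem lusin_compact: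
  fixes M :: "'a::polish_space measure" and f :: "'a \<Rightarrow> 'b::second_countable_topology"
  assumes fin: "finite_measure M" and sets: "sets M = sets borel" and C: "C \<in> sets borel"
    and f[measurable]: "f \<in> borel_measurable borel" and e: "e > 0"
  obtains K where "compact K" "K \<subseteq> C" "measure M (C - K) \<le> e" "continuous_on K f"
proof -
  interpret finite_measure M by fact
  define V :: "nat \<Rightarrow> 'b set" where "V = base"
  \<comment> \<open>Two losses of \<open>a n\<close> at each stage make
    \<open>e * (1/2)^Suc n\<close>, and these sum to \<open>e\<close>.\<close>
  define a where "a n = e * (1/2)^Suc (Suc n)" for n
  have a: "a n > 0" for n using e by (simp add: a_def)
  have V'[measurable]: "V n \<in> sets borel" for n by (simp add: V_def)
  have b1: "C \<inter> f -` V n \<in> sets borel" "C - f -` V n \<in> sets borel" for n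
    using C measurable_sets[OF f V', of n] by auto
  have "\<exists>K L. compact K \<and> compact L \<and> K \<subseteq> C \<inter> f -` V n \<and> L \<subseteq> C - f -` V n \<and>
       measure M (C \<inter> f -` V n - K) \<le> a n \<and> measure M (C - f -` V n - L) \<le> a n" for n
    using finite_measure_inner_compact[OF fin sets b1(1)[of n] a[of n]]
      finite_measure_inner_compact[OF fin sets b1(2)[of n] a[of n]] by metis
  then obtain K L where K: "\<And>n. compact (K n)" "\<And>n. compact (L n)"
    "\<And>n. K n \<subseteq> C \<inter> f -` V n" "\<And>n. L n \<subseteq> C - f -` V n"
    "\<And>n. measure M (C \<inter> f -` V n - K n) \<le> a n" "\<And>n. measure M (C - f -` V n - L n) \<le> a n"
    by metis
  define Z where "Z = (\<Inter>n. K n \<union> L n)"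
  have KM[measurable]: "K n \<in> sets M" "L n \<in> sets M" for n
    using K sets by (auto simp: borel_compact)
  have CM: "C \<in> sets M" "C \<inter> f -` V n \<in> sets M" "C - f -` V n \<in> sets M" for n
    using C b1 sets by auto
  have step: "measure M (C - (K n \<union> L n)) \<le> e * (1/2)^Suc n" for n
  proof -
    have "C - (K n \<union> L n) \<subseteq> (C \<inter> f -` V n - K n) \<union> (C - f -` V n - L n)" by auto
    then have "measure M (C - (K n \<union> L n)) \<le> measure M ((C \<inter> f -` V n - K n) \<union> (C - f -` V n - L n))"
      using CM by (intro finite_measure_mono) auto
    also have "\<dots> \<le> measure M (C \<inter> f -` V n - K n) + measure M (C - f -` V n - L n)"
      using CM by (intro measure_Un_le) auto
    also have "\<dots> \<le> a n + a n" using K by (intro add_mono) auto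
    finally show ?thesis by (simp add: a_def)
  qed
  have "compact ((K 0 \<union> L 0) \<inter> Z)"
    unfolding Z_def using K
    by (intro compact_Int_closed closed_INT ballI closed_Un compact_Un compact_imp_closed) auto
  moreover have "(K 0 \<union> L 0) \<inter> Z = Z" by (auto simp: Z_def)
  ultimately have "compact Z" by simp
  moreover have "Z \<subseteq> C" using K(3,4)[of 0] by (auto simp: Z_def)
  moreover have "measure M (C - Z) \<le> e"
  proof -
    have sm: "(\<lambda>n. e * (1/2)^Suc n) sums (e * 1)"
      by (intro sums_mult power_half_series)
    have sm': "summable (\<lambda>n. measure M (C - (K n \<union> L n)))"
      by (rule summable_comparison_test'[OF sums_summable[OF sm]]) (use step in auto)
    have CZ: "C - Z = (\<Union>n. C - (K n \<union> L n))" by (auto simp: Z_def)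
    have "measure M (C - Z) \<le> (\<Sum>n. measure M (C - (K n \<union> L n)))"
      unfolding CZ using CM(1) sm' by (intro finite_measure_subadditive_countably) auto
    also have "\<dots> \<le> (\<Sum>n. e * (1/2)^Suc n)"
      using step sm' sums_summable[OF sm] by (intro suminf_le) auto
    also have "\<dots> = e" using sums_unique[OF sm] by simp
    finally show ?thesis .
  qed
  moreover have "continuous_on Z f"
    unfolding continuous_on_topological
  proof (intro ballI allI impI)
    fix x W assume x: "x \<in> Z" and W: "open W" "f x \<in> W"
    obtain n where B: "f x \<in> V n" "V n \<subseteq> W" using baseE[OF W] unfolding V_def .
    have "x \<notin> L n" using B K(4)[of n] by auto
    moreover have "f y \<in> W" if "y \<in> Z" "y \<notin> L n" for y
      using that K(3)[of n] B by (auto simp: Z_def)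
    ultimately show "\<exists>A. open A \<and> x \<in> A \<and> (\<forall>y\<in>Z. y \<in> A \<longrightarrow> f y \<in> W)"
      using compact_imp_closed[OF K(2)[of n]] by (intro exI[of _ "- L n"]) auto
  qed
  ultimately show thesis using that by blast
qed

text \<open>The set P is the essential image of A under g, taken among the images of points of K: it is the
  set where the density of the image of A with respect to the image of K is positive.\<close>

lemma essential_image:
  fixes M :: "'a::topological_space measure" and g :: "'a \<Rightarrow> 'b::topological_space"
  assumes "finite_measure M" and sets: "sets M = sets borel"
    and A: "A \<in> sets borel" and K: "K \<in> sets borel" and "A \<subseteq> K"
    and g: "g \<in> borel_measurable borel"
  shows "\<exists>P\<in>sets borel. \<forall>B\<in>sets borel.
    measure M (A \<inter> g -` B) = 0 \<longleftrightarrow> measure M (K \<inter> g -` (B \<inter> P)) = 0"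
proof -
  interpret finite_measure M by fact
  have sp: "space M = UNIV" using sets_eq_imp_space_eq[OF sets] by simp
  have g'[measurable]: "g \<in> borel_measurable M" using g sets measurable_cong_sets by blast
  have [measurable]: "A \<in> sets M" "K \<in> sets M" using A K sets by auto
  \<comment> \<open>\<open>\<nu> C\<close> is the image under \<open>g\<close> of the restriction of
    \<open>M\<close> to \<open>C\<close>; from \<open>A \<subseteq> K\<close> it follows that
    \<open>\<nu> A\<close> is dominated by \<open>\<nu> K\<close>, so it has a density.\<close>
  define \<nu> where "\<nu> C = distr (density M (indicator C)) borel g" for C
  have \<nu>: "emeasure (\<nu> C) B = emeasure M (C \<inter> g -` B)" if "C \<in> sets M" "B \<in> sets borel" for B C
  proof -
    have "g -` B \<in> sets M" using measurable_sets[OF g' that(2)] sp by simp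
    then show ?thesis using that
      by (simp add: \<nu>_def emeasure_distr emeasure_restricted sp)
  qed
  have fin: "finite_measure (\<nu> K)"
    by (rule finite_measureI) (use \<nu>[of K UNIV] in \<open>simp add: \<nu>_def emeasure_eq_measure\<close>)
  interpret \<nu>: finite_measure "\<nu> K" by fact
  have setsn: "sets (\<nu> C) = sets borel" for C by (simp add: \<nu>_def)
  have mono: "emeasure (\<nu> A) B \<le> emeasure (\<nu> K) B" if "B \<in> sets borel" for B
  proof -
    have "g -` B \<in> sets M" using measurable_sets[OF g' that] sp by simp
    then show ?thesis using that \<open>A \<subseteq> K\<close> by (auto simp: \<nu> intro!: emeasure_mono)
  qed
  have ac: "absolutely_continuous (\<nu> K) (\<nu> A)"
    unfolding absolutely_continuous_def
  proof
    fix B assume "B \<in> null_sets (\<nu> K)"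
    then show "B \<in> null_sets (\<nu> A)" using mono[of B] by (auto simp: null_sets_def setsn)
  qed
  define P where "P = {y. RN_deriv (\<nu> K) (\<nu> A) y \<noteq> 0}"
  have h: "RN_deriv (\<nu> K) (\<nu> A) \<in> borel_measurable borel"
    using borel_measurable_RN_deriv[of "\<nu> K" "\<nu> A"] setsn[of K] measurable_cong_sets by blast
  have P: "P \<in> sets borel" using h unfolding P_def by measurable
  show ?thesis
  proof (intro bexI[OF _ P] ballI)
    fix B :: "'b set" assume B: "B \<in> sets borel"
    have "measure M (A \<inter> g -` B) = 0 \<longleftrightarrow> emeasure (\<nu> A) B = 0"
      using B by (simp add: \<nu> emeasure_eq_measure)
    also have "emeasure (\<nu> A) B = emeasure (density (\<nu> K) (RN_deriv (\<nu> K) (\<nu> A))) B"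
      using \<nu>.density_RN_deriv[OF ac] setsn by simp
    also have "\<dots> = (\<integral>\<^sup>+y. RN_deriv (\<nu> K) (\<nu> A) y * indicator B y \<partial>\<nu> K)"
      using B setsn by (intro emeasure_density) auto
    also have "\<dots> = 0 \<longleftrightarrow> emeasure (\<nu> K) {y \<in> space (\<nu> K). RN_deriv (\<nu> K) (\<nu> A) y * indicator B y \<noteq> 0} = 0"
      using B setsn by (intro nn_integral_0_iff borel_measurable_times_ennreal borel_measurable_RN_deriv borel_measurable_indicator) auto
    also have "{y \<in> space (\<nu> K). RN_deriv (\<nu> K) (\<nu> A) y * indicator B y \<noteq> 0} = B \<inter> P"
      by (auto simp: P_def \<nu>_def indicator_def)
    also have "emeasure (\<nu> K) (B \<inter> P) = 0 \<longleftrightarrow> measure M (K \<inter> g -` (B \<inter> P)) = 0"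
      using B P by (simp only: \<nu> sets.Int \<open>K \<in> sets M\<close>) (simp add: emeasure_eq_measure)
    finally show "measure M (A \<inter> g -` B) = 0 \<longleftrightarrow> measure M (K \<inter> g -` (B \<inter> P)) = 0" .
  qed
qed

section \<open>Measures invariant along an equivalence relation\<close>

text \<open>A continuous image of a compact set is compact, hence Borel, as
  \<open>partial_borel_bij\<close> demands of images. Lusin's theorem carries conclusions from this
  case to Borel maps.\<close>

locale compact_invariant =
  fixes M :: "'a::polish_space measure" and R :: "'a rel"
  assumes fin: "finite_measure M" and sets_M: "sets M = sets borel"
    and sym_R: "sym R" and trans_R: "trans R"
    and inv: "\<And>K f. \<lbrakk>compact K; continuous_on K f; inj_on f K; \<forall>x\<in>K. (x, f x) \<in> R\<rbrakk>
      \<Longrightarrow> measure M (f ` K) = measure M K"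
begin

sublocale finite_measure M by (rule fin)

lemma space_M: "space M = UNIV"
  using sets_eq_imp_space_eq[OF sets_M] by simp

text \<open>A compact part of \<open>C\<close> on which \<open>f\<close> is continuous has the
  measure of its image, hence 0, while missing arbitrarily little of \<open>C\<close>.\<close>

lemma measure_inj_into_null:
  assumes C: "C \<in> sets borel" and f: "f \<in> borel_measurable borel" and "inj_on f C"
    and R: "\<And>x. x \<in> C \<Longrightarrow> (x, f x) \<in> R" and N: "f ` C \<subseteq> N" "N \<in> null_sets M"
  shows "measure M C = 0"
proof -
  have "measure M C \<le> 0 + e" if "e > 0" for e
  proof -
    obtain K where K: "compact K" "K \<subseteq> C" "measure M (C - K) \<le> e" "continuous_on K f"
      using lusin_compact[OF fin sets_M C f \<open>e > 0\<close>] .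
    have m: "C \<in> sets M" "K \<in> sets M" using C K sets_M by (auto simp: borel_compact)
    have "measure M K = measure M (f ` K)"
      using K R \<open>inj_on f C\<close> by (intro inv[symmetric]) (auto intro: inj_on_subset)
    also have "\<dots> \<le> measure M N"
      using K N by (intro finite_measure_mono) auto
    also have "\<dots> = 0" using N(2) by (simp add: measure_eq_0_null_sets)
    finally have "measure M K \<le> 0" .
    moreover have "measure M (C - K) = measure M C - measure M K"
      using m K by (intro finite_measure_Diff) auto
    ultimately show ?thesis using K(3) by linarith
  qed
  then have "measure M C \<le> 0" by (rule field_le_epsilon)
  then show ?thesis using measure_nonneg[of M C] by linarith
qed

text \<open>Otherwise, by Lusin's theorem, g maps a compact set K of positive measure continuously into the
  null set. Sets on which g is injective are null, so almost every fibre of g carries a measure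
  without atoms, and the cylinders of positive fibre measure contain a binary branching scheme.
  Following it along the binary code of a point (preceded by one free bit) gives two
  measure-preserving injections of K into K along the fibres, with disjoint images.\<close>

theorem measure_into_null:
  assumes C: "C \<in> sets borel" and g[measurable]: "g \<in> borel_measurable borel"
    and R: "\<And>x. x \<in> C \<Longrightarrow> (x, g x) \<in> R" and N: "g ` C \<subseteq> N" "N \<in> null_sets M"
  shows "measure M C = 0"
proof (rule ccontr)
  assume "measure M C \<noteq> 0"
  then have posC: "measure M C > 0" using measure_nonneg[of M C] by linarith
  define U :: "nat \<Rightarrow> 'a set" where "U = base"
  have [measurable]: "U n \<in> sets borel" for n by (simp add: U_def)
  have sep: "x = y" if "\<And>n. x \<in> U n \<longleftrightarrow> y \<in> U n" for x y
  proof (rule ccontr)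
    assume "x \<noteq> y"
    then obtain W where W: "open W" "x \<in> W" "y \<notin> W" using t1_space by blast
    obtain n where "x \<in> U n" "U n \<subseteq> W" using baseE[OF W(1,2)] unfolding U_def .
    with W that show False by blast
  qed
  \<comment> \<open>Continuity of \<open>bits\<close> on \<open>K\<close> makes each
    \<open>U n\<close> relatively clopen there, so that the cylinders \<open>A s\<close> are
    compact.\<close>
  define bits :: "'a \<Rightarrow> nat \<Rightarrow> real" where "bits x n = indicator (U n) x" for x n
  have bits[measurable]: "bits \<in> borel_measurable borel"
    by (rule measurable_coordinatewise_then_product) (simp add: bits_def)
  have "(\<lambda>x. (g x, bits x)) \<in> borel_measurable borel" by measurable
  then obtain K where K: "compact K" "K \<subseteq> C" "measure M (C - K) \<le> measure M C / 2"
    "continuous_on K (\<lambda>x. (g x, bits x))"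
    using lusin_compact[OF fin sets_M C, of "\<lambda>x. (g x, bits x)" "measure M C / 2"] posC by auto
  have contg: "continuous_on K g" and contb: "continuous_on K bits"
    using continuous_on_fst[OF K(4)] continuous_on_snd[OF K(4)] by simp_all
  have Kb[measurable]: "K \<in> sets borel" using K by (simp add: borel_compact)
  have mk: "measure M K > 0"
    using K posC finite_measure_Diff[of C K] C Kb sets_M by simp

  define A where "A s = {x \<in> K. \<forall>i<length s. (x \<in> U i) = s ! i}" for s :: "bool list"
  have A_subset: "A s \<subseteq> K" for s by (auto simp: A_def)
  have compA: "compact (A s)" for s
  proof -
    have eq: "A s = K \<inter> bits -` {z. \<forall>i<length s. z i = of_bool (s ! i)}"
      by (auto simp: A_def bits_def indicator_def)
    have cl: "closed {z :: nat \<Rightarrow> real. \<forall>i<length s. z i = of_bool (s ! i)}"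
      by (intro closed_Collect_all closed_Collect_imp closed_Collect_eq continuous_intros
          continuous_on_product_coordinates) auto
    have "closed (A s)"
      unfolding eq by (rule continuous_closed_preimage[OF contb compact_imp_closed[OF K(1)] cl])
    then have "compact (K \<inter> A s)" by (rule compact_Int_closed[OF K(1)])
    then show ?thesis using A_subset[of s] by (simp add: Int_absorb1)
  qed
  have Ab[measurable]: "A s \<in> sets borel" for s using compA by (simp add: borel_compact)
  define nul where "nul B \<longleftrightarrow> measure M (K \<inter> g -` B) = 0" for B
  have "\<forall>s. \<exists>P\<in>sets borel. \<forall>B\<in>sets borel. measure M (A s \<inter> g -` B) = 0 \<longleftrightarrow> nul (B \<inter> P)"
    unfolding nul_def using essential_image[OF fin sets_M Ab Kb A_subset g] by blast
  then obtain P where Pb[measurable]: "\<And>s. P s \<in> sets borel"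
    and P: "\<And>s B. B \<in> sets borel \<Longrightarrow> measure M (A s \<inter> g -` B) = 0 \<longleftrightarrow> nul (B \<inter> P s)"
    by metis
  have gb[measurable]: "g -` B \<in> sets borel" if "B \<in> sets borel" for B
    using measurable_sets[OF g that] by simp
  have nul_empty: "nul {}" by (simp add: nul_def)
  have nulD: "K \<inter> g -` B \<in> null_sets M" if "nul B" "B \<in> sets borel" for B
    using that Kb gb[OF that(2)] by (auto simp: nul_def null_sets_def emeasure_eq_measure sets_M)

  \<comment> \<open>A branching of the cylinder \<open>s\<close> over \<open>y\<close> into two
    cylinders with mass over \<open>y\<close>. Equal lengths will let an image point reveal which
    branch was taken.\<close>
  define split where "split s y p \<longleftrightarrow> y \<in> P (fst p) \<and> y \<in> P (snd p) \<and> length (fst p) = length (snd p)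
    \<and> fst p \<noteq> snd p \<and> take (length s) (fst p) = s \<and> take (length s) (snd p) = s" for s y p
  have split_m: "Measurable.pred borel (\<lambda>y. split s y p)" for s p
    unfolding split_def by measurable
  define Bad where "Bad s = {y \<in> P s. \<not> (\<exists>p. split s y p)}" for s
  have Badb[measurable]: "Bad s \<in> sets borel" for s
    unfolding Bad_def using split_m by measurable

  define code where "code x n = map (\<lambda>i. x \<in> U i) [0..<n]" for x n
  have A_code: "x \<in> A (code x n)" if "x \<in> K" for x n using that by (simp add: A_def code_def)
  have code_A: "s = code x (length s)" if "x \<in> A s" for x s
    using that by (auto simp: A_def code_def intro!: nth_equalityI)
  \<comment> \<open>Points lying in some cylinder without mass over their own fibre. For every other
    \<open>x\<close> in \<open>K\<close>, all codes \<open>s\<close> of \<open>x\<close> satisfy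
    \<open>g x \<in> P s\<close>.\<close>
  define Irr where "Irr = (\<Union>s. A s \<inter> g -` (- P s))"
  have Irr: "Irr \<in> null_sets M"
    unfolding Irr_def
  proof (intro null_sets_UN)
    fix s
    have "measure M (A s \<inter> g -` (- P s)) = 0" using P[of "- P s" s] nul_empty by simp
    then show "A s \<inter> g -` (- P s) \<in> null_sets M"
      using gb[of "- P s"] by (auto simp: null_sets_def emeasure_eq_measure sets_M)
  qed
  have nulBad: "nul (Bad s)" for s
  proof -
    let ?T = "A s \<inter> g -` Bad s - Irr"
    have Tb: "?T \<in> sets borel" using Irr gb[OF Badb] by (auto simp: null_sets_def sets_M)
    \<comment> \<open>Two points of one fibre differ in some digit, so sufficiently long codes of
      them would split \<open>s\<close>, contrary to \<open>Bad s\<close>.\<close>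
    have "inj_on g ?T"
    proof (rule inj_onI, rule ccontr)
      fix x x' assume x: "x \<in> ?T" and x': "x' \<in> ?T" and eq: "g x = g x'" and "x \<noteq> x'"
      then obtain i where i: "(x \<in> U i) \<noteq> (x' \<in> U i)" using sep by blast
      \<comment> \<open>Long enough both to show digit \<open>i\<close> and to extend
        \<open>s\<close>.\<close>
      define n where "n = max (Suc i) (length s)"
      have "x \<in> K" "x' \<in> K" using x x' A_subset by auto
      then have "g x \<in> P (code x n)" "g x \<in> P (code x' n)"
        using x x' A_code[of x n] A_code[of x' n] eq by (auto simp: Irr_def)
      moreover have "i < n" by (simp add: n_def)
      then have "code x n ! i \<noteq> code x' n ! i" using i by (simp add: code_def)
      then have "code x n \<noteq> code x' n" by auto
      moreover have "take (length s) (code z n) = s" if "z \<in> A s" for z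
      proof -
        have "take (length s) (code z n) = code z (length s)"
          by (simp add: code_def n_def take_map min_def)
        then show ?thesis using code_A[OF that] by simp
      qed
      ultimately have "split s (g x) (code x n, code x' n)"
        using x x' by (auto simp: split_def code_def)
      then show False using x by (auto simp: Bad_def)
    qed
    moreover have "?T \<subseteq> C" using A_subset[of s] K(2) by blast
    then have "g ` ?T \<subseteq> N" "\<And>x. x \<in> ?T \<Longrightarrow> (x, g x) \<in> R" using N(1) R by (blast, blast)
    ultimately have "measure M ?T = 0"
      using N(2) by (intro measure_inj_into_null[OF Tb g])
    then have "?T \<in> null_sets M" using Tb by (auto simp: null_sets_def emeasure_eq_measure sets_M)
    then have "?T \<union> Irr \<in> null_sets M" using Irr by (rule null_sets.Un)
    moreover have "A s \<inter> g -` Bad s \<in> sets M" using gb[OF Badb] by (simp add: sets_M)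
    ultimately have "A s \<inter> g -` Bad s \<in> null_sets M" by (rule null_sets_subset) auto
    then have "measure M (A s \<inter> g -` Bad s) = 0" by (simp add: null_sets_def emeasure_eq_measure)
    moreover have "Bad s \<inter> P s = Bad s" by (auto simp: Bad_def)
    ultimately show ?thesis using P[OF Badb, of s s] by simp
  qed

  have imgb[measurable]: "g ` A s \<in> sets borel" for s
    using compact_continuous_image[OF continuous_on_subset[OF contg A_subset] compA]
    by (simp add: borel_compact)
  \<comment> \<open>\<open>P s\<close> matters only up to null sets. Dropping what the image of
    \<open>A s\<close> misses ensures that the cylinder meets the fibre, as the compactness argument
    in \<open>point_ex\<close> requires.\<close>
  have nulimg: "nul (P s - g ` A s)" for s
  proof -
    have "A s \<inter> g -` (P s - g ` A s) = {}" by auto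
    then have "measure M (A s \<inter> g -` (P s - g ` A s)) = 0" by simp
    moreover have "(P s - g ` A s) \<inter> P s = P s - g ` A s" by auto
    ultimately show ?thesis using P[of "P s - g ` A s" s] by simp
  qed
  have nulroot: "nul (- P [])"
    using P[of "- P []" "[]"] nul_empty by (simp add: nul_def A_def)
  define K1 where "K1 = K - (K \<inter> g -` (- P []) \<union> (\<Union>s. K \<inter> g -` Bad s) \<union> (\<Union>s. K \<inter> g -` (P s - g ` A s)))"
  have bnull: "K \<inter> g -` (- P []) \<union> (\<Union>s. K \<inter> g -` Bad s) \<union> (\<Union>s. K \<inter> g -` (P s - g ` A s)) \<in> null_sets M"
    by (intro null_sets.Un null_sets_UN nulD nulBad nulimg nulroot) auto
  have K1b[measurable]: "K1 \<in> sets borel"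
    unfolding K1_def using bnull by (intro sets.Diff Kb) (simp add: null_sets_def sets_M)
  have mK1: "measure M K1 = measure M K"
    unfolding K1_def using bnull by (intro measure_Diff_null_set) (auto simp: sets_M)
  have K1: "x \<in> K" "g x \<in> P []" "\<And>s. g x \<in> P s \<Longrightarrow> (\<exists>p. split s (g x) p)"
    "\<And>s. g x \<in> P s \<Longrightarrow> g x \<in> g ` A s" if "x \<in> K1" for x
    using that by (auto simp: K1_def Bad_def)

  \<comment> \<open>Pairs of words are countable, so taking the least numbered one is a Borel
    choice.\<close>
  define tt where "tt s y = (from_nat (LEAST n. split s y (from_nat n)) :: bool list \<times> bool list)" for s y
  have tt: "split s y (tt s y)" if "\<exists>p. split s y p" for s y
  proof -
    have "\<exists>n. split s y (from_nat n)" using that by (metis from_nat_to_nat)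
    then show ?thesis unfolding tt_def by (rule LeastI_ex)
  qed
  have tt_m: "(\<lambda>y. tt s y) \<in> measurable borel (count_space UNIV)" for s
    unfolding tt_def
    by (rule measurable_compose[OF measurable_Least[OF split_m]]) simp
  \<comment> \<open>Digit 0 is the free bit; the digits of \<open>x\<close> are shifted by
    one.\<close>
  define z where "z k x n = (case n of 0 \<Rightarrow> k | Suc m \<Rightarrow> x \<in> U m)" for k :: bool and x n
  have z_m: "Measurable.pred borel (\<lambda>x. z k x n)" for k n
    unfolding z_def by (cases n) simp_all
  define \<tau> where "\<tau> k x = rec_nat [] (\<lambda>n s. if z k x n then fst (tt s (g x)) else snd (tt s (g x)))"
    for k x
  have \<tau>0: "\<tau> k x 0 = []" and \<tau>S: "\<tau> k x (Suc n) =
      (if z k x n then fst (tt (\<tau> k x n) (g x)) else snd (tt (\<tau> k x n) (g x)))" for k x n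
    by (simp_all add: \<tau>_def)
  have \<tau>_m: "(\<lambda>x. \<tau> k x n) \<in> measurable borel (count_space UNIV)" for k n
  proof (induction n)
    case 0
    then show ?case by (simp add: \<tau>0)
  next
    case (Suc n)
    have "(\<lambda>x. tt s (g x)) \<in> measurable borel (count_space UNIV)" for s
      using measurable_compose[OF g tt_m] .
    then have m: "(\<lambda>x. tt (\<tau> k x n) (g x)) \<in> measurable borel (count_space UNIV)"
      by (rule measurable_compose_countable[OF _ Suc])
    have "(\<lambda>x. fst (tt (\<tau> k x n) (g x))) \<in> measurable borel (count_space UNIV)"
      "(\<lambda>x. snd (tt (\<tau> k x n) (g x))) \<in> measurable borel (count_space UNIV)"
      by (rule measurable_compose[OF m], simp)+
    then show ?case unfolding \<tau>S using z_m[of k n] by (intro measurable_If) (auto simp: pred_def)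
  qed
  have \<tau>P: "g x \<in> P (\<tau> k x n)" if "x \<in> K1" for k x n
  proof (induction n)
    case 0
    then show ?case using K1(2)[OF that] by (simp add: \<tau>0)
  next
    case (Suc n)
    then show ?case using tt[OF K1(3)[OF that Suc]] by (simp add: \<tau>S split_def)
  qed
  have \<tau>_split: "split (\<tau> k x n) (g x) (tt (\<tau> k x n) (g x))" if "x \<in> K1" for k x n
    using tt[OF K1(3)[OF that \<tau>P[OF that]]] .
  have \<tau>_take: "take (length (\<tau> k x n)) (\<tau> k x (Suc n)) = \<tau> k x n" if "x \<in> K1" for k x n
    using \<tau>_split[OF that, of k n] by (simp add: \<tau>S split_def)
  \<comment> \<open>Two distinct words of equal length extending \<open>s\<close> are both longer
    than \<open>s\<close>.\<close>
  have \<tau>_len: "length (\<tau> k x n) < length (\<tau> k x (Suc n))" if "x \<in> K1" for k x n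
  proof (rule ccontr)
    let ?s = "\<tau> k x n" and ?p = "tt (\<tau> k x n) (g x)"
    assume "\<not> ?thesis"
    then have "length (fst ?p) \<le> length ?s"
      using \<tau>_split[OF that, of k n] by (auto simp: \<tau>S split_def split: if_splits)
    then have "fst ?p = ?s" "snd ?p = ?s"
      using \<tau>_split[OF that, of k n] unfolding split_def by (metis take_all)+
    then show False using \<tau>_split[OF that, of k n] by (simp add: split_def)
  qed
  have \<tau>_len': "n \<le> length (\<tau> k x n)" if "x \<in> K1" for k x n
  proof (induction n)
    case (Suc n)
    then show ?case using \<tau>_len[OF that, of k n] by linarith
  qed simp
  have A_take: "A t \<subseteq> A s" if "take (length s) t = s" for s t
  proof -
    have "length s \<le> length t" using that by (metis length_take min.cobounded1)
    moreover have "t ! i = s ! i" if "i < length s" for i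
      using \<open>take (length s) t = s\<close> that by (metis nth_take)
    ultimately show ?thesis unfolding A_def by (auto dest: less_le_trans)
  qed
  have A_dec: "A (\<tau> k x m) \<subseteq> A (\<tau> k x n)" if "x \<in> K1" "n \<le> m" for k x n m
    using lift_Suc_antimono_le[of "\<lambda>n. A (\<tau> k x n)" n m] A_take[OF \<tau>_take[OF that(1)]] that(2) by blast
  \<comment> \<open>The cylinders along the path meet the fibre of \<open>g x\<close> in nested
    nonempty compact sets.\<close>
  have point_ex: "\<exists>p. (\<forall>n. p \<in> A (\<tau> k x n)) \<and> g p = g x" if x: "x \<in> K1" for k x
  proof -
    define F where "F n = A (\<tau> k x n) \<inter> g -` {g x}" for n
    have clF: "closed (F n)" for n
      unfolding F_def using continuous_closed_preimage[OF continuous_on_subset[OF contg A_subset]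
        compact_imp_closed[OF compA] closed_singleton] .
    have "K \<inter> (\<Inter>n\<in>UNIV. F n) \<noteq> {}"
    proof (rule compact_imp_fip_image[OF K(1) clF])
      fix I :: "nat set" assume I: "finite I"
      obtain m where m: "\<And>i. i \<in> I \<Longrightarrow> i \<le> m" using I finite_nat_set_iff_bounded_le by auto
      obtain p where p: "p \<in> A (\<tau> k x m)" "g p = g x" using K1(4)[OF x \<tau>P[OF x, of k m]] by force
      have "p \<in> F i" if "i \<in> I" for i using A_dec[OF x m[OF that], of k] p by (auto simp: F_def)
      moreover have "p \<in> K" using p A_subset by auto
      ultimately show "K \<inter> (\<Inter>i\<in>I. F i) \<noteq> {}" by blast
    qed
    then show ?thesis by (auto simp: F_def)
  qed
  define \<Phi> where "\<Phi> k x = (if x \<in> K1 then SOME p. (\<forall>n. p \<in> A (\<tau> k x n)) \<and> g p = g x else undefined)" for k x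
  have \<Phi>: "\<Phi> k x \<in> A (\<tau> k x n)" "g (\<Phi> k x) = g x" if "x \<in> K1" for k x n
    using someI_ex[OF point_ex[OF that, of k]] that by (auto simp: \<Phi>_def)
  have \<Phi>_out: "\<Phi> k x = undefined" if "x \<notin> K1" for k x
    using that by (simp add: \<Phi>_def)
  \<comment> \<open>After \<open>Suc m\<close> steps the word has a digit \<open>m\<close>. So
    membership in each generator \<open>U m\<close> is read from a Borel function with countably
    many values, which makes \<Phi> Borel.\<close>
  have \<Phi>U: "\<Phi> k x \<in> U m \<longleftrightarrow> \<tau> k x (Suc m) ! m" if "x \<in> K1" for k x m
    using \<Phi>(1)[OF that, of k "Suc m"] \<tau>_len'[OF that, of "Suc m" k] by (auto simp: A_def)
  have borel_U: "borel = sigma UNIV (range U)"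
    using borel_eq_countable_basis[OF _ topological_basis_base] by (simp add: U_def)
  have \<Phi>_m: "\<Phi> k \<in> borel_measurable borel" for k
    unfolding borel_U
  proof (rule measurable_sigma_sets)
    show "sets (sigma UNIV (range U)) = sigma_sets UNIV (range U)" by simp
    fix V assume "V \<in> range U"
    then obtain m where m: "V = U m" by auto
    have "\<Phi> k -` V \<inter> space borel = {x. x \<in> K1 \<and> \<tau> k x (Suc m) ! m} \<union> {x. x \<notin> K1 \<and> undefined \<in> V}"
    proof (rule set_eqI)
      fix x
      show "x \<in> \<Phi> k -` V \<inter> space borel \<longleftrightarrow>
        x \<in> {x. x \<in> K1 \<and> \<tau> k x (Suc m) ! m} \<union> {x. x \<notin> K1 \<and> undefined \<in> V}"
        using \<Phi>U[of x k m] by (cases "x \<in> K1") (simp_all add: m \<Phi>_out)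
    qed
    also have "\<dots> \<in> sets borel"
    proof -
      have "Measurable.pred borel (\<lambda>x. \<tau> k x (Suc m) ! m)"
        by (rule measurable_compose[OF \<tau>_m]) simp
      then show ?thesis by measurable
    qed
    finally show "\<Phi> k -` V \<inter> space (sigma UNIV (range U)) \<in> sets (sigma UNIV (range U))"
      by (simp add: borel_U[symmetric])
  qed (auto)
  \<comment> \<open>Since \<open>g\<close> is preserved, both paths use the same pairs as long as
    they agree. The words of a pair have equal length, so the common image point fixes the next
    word; its position in the pair is the digit.\<close>
  have \<Phi>_inj: "k = k' \<and> x = x'" if x: "x \<in> K1" "x' \<in> K1" and eq: "\<Phi> k x = \<Phi> k' x'" for k k' x x'
  proof -
    have geq: "g x = g x'" using \<Phi>(2) x eq by metis
    have st: "\<tau> k x n = \<tau> k' x' n \<and> (\<forall>j<n. z k x j = z k' x' j)" for n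
    proof (induction n)
      case 0
      then show ?case by (simp add: \<tau>0)
    next
      case (Suc n)
      let ?p = "tt (\<tau> k x n) (g x)"
      have len: "length (\<tau> k x (Suc n)) = length (\<tau> k' x' (Suc n))"
        using Suc geq \<tau>_split[OF x(1), of k n] by (auto simp: \<tau>S split_def)
      have "\<tau> k x (Suc n) = \<tau> k' x' (Suc n)"
        using code_A[OF \<Phi>(1)[OF x(1), of k "Suc n"]] code_A[OF \<Phi>(1)[OF x(2), of k' "Suc n"]] len eq
        by metis
      moreover from this have "z k x n = z k' x' n"
        using Suc geq \<tau>_split[OF x(1), of k n] by (auto simp: \<tau>S split_def split: if_splits)
      ultimately show ?case using Suc by (auto simp: less_Suc_eq)
    qed
    have zz: "z k x j = z k' x' j" for j using st[of "Suc j"] by blast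
    have "k = k'" using zz[of 0] by (simp add: z_def)
    moreover have "x = x'" by (rule sep) (use zz[of "Suc _"] in \<open>simp add: z_def\<close>)
    ultimately show ?thesis ..
  qed
  have "(\<lambda>x. (\<Phi> False x, \<Phi> True x)) \<in> borel_measurable borel"
    using \<Phi>_m[of False] \<Phi>_m[of True] by measurable
  \<comment> \<open>Losing at most a third leaves two disjoint copies of \<open>L\<close> with total
    measure at least \<open>4/3\<close> that of \<open>K\<close>. Pairing the maps yields one
    \<open>L\<close> for both.\<close>
  then obtain L where L: "compact L" "L \<subseteq> K1" "measure M (K1 - L) \<le> measure M K / 3"
    "continuous_on L (\<lambda>x. (\<Phi> False x, \<Phi> True x))"
    using lusin_compact[OF fin sets_M K1b, of "\<lambda>x. (\<Phi> False x, \<Phi> True x)" "measure M K / 3"] mk by auto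
  have contL: "continuous_on L (\<Phi> k)" for k
    using continuous_on_fst[OF L(4)] continuous_on_snd[OF L(4)] by (cases k) simp_all
  have mL: "measure M L \<ge> measure M K * (2/3)"
    using L finite_measure_Diff[of K1 L] K1b mK1 sets_M by (simp add: borel_compact)
  have inR: "(x, \<Phi> k x) \<in> R" if "x \<in> L" for k x
  proof -
    have x1: "x \<in> K1" using that L by auto
    have "\<Phi> k x \<in> C" using \<Phi>(1)[OF x1, of k 0] A_subset K(2) by auto
    then have "(\<Phi> k x, g x) \<in> R" using R \<Phi>(2)[OF x1] by metis
    moreover have "(x, g x) \<in> R" using R K1(1)[OF x1] K(2) by auto
    ultimately show ?thesis using sym_R trans_R by (meson symD transD)
  qed
  have im: "measure M (\<Phi> k ` L) = measure M L" "compact (\<Phi> k ` L)" "\<Phi> k ` L \<subseteq> K" for k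
  proof -
    have "inj_on (\<Phi> k) L" using \<Phi>_inj L(2) by (meson inj_onI subsetD)
    then show "measure M (\<Phi> k ` L) = measure M L" using inv[OF L(1) contL] inR by blast
    show "compact (\<Phi> k ` L)" using compact_continuous_image[OF contL L(1)] .
    show "\<Phi> k ` L \<subseteq> K" using \<Phi>(1) L(2) A_subset by blast
  qed
  have "\<Phi> False ` L \<inter> \<Phi> True ` L = {}" using \<Phi>_inj L(2) by blast
  then have "measure M (\<Phi> False ` L \<union> \<Phi> True ` L) = measure M L + measure M L"
    using im by (subst finite_measure_Union) (auto simp: sets_M borel_compact)
  moreover have "measure M (\<Phi> False ` L \<union> \<Phi> True ` L) \<le> measure M K"
    using im Kb by (intro finite_measure_mono) (auto simp: sets_M)
  ultimately show False using mL mk by linarith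
qed

end

section \<open>Neighbourhoods and mass transport in regular graphs\<close>

text \<open>Gives each neighbour a countable index, which turns existence of neighbours into
  countable unions.\<close>

lemma base_isolate:
  fixes y :: "'a::polish_space"
  assumes "finite F" obtains n where "y \<in> base n" "base n \<inter> F \<subseteq> {y}"
proof -
  have "open (- (F - {y}))" using assms by (intro open_Compl finite_imp_closed) auto
  then obtain n where "y \<in> base n" "base n \<subseteq> - (F - {y})" by (rule baseE) auto
  with that show thesis by blast
qed

lemma borel_Collect_eq:
  fixes f g :: "'a::topological_space \<Rightarrow> 'b::polish_space"
  assumes [measurable]: "f \<in> borel_measurable borel" "g \<in> borel_measurable borel"
  shows "{x. f x = g x} \<in> sets borel"
proof -
  have "(\<lambda>x. (f x, g x)) -` {p. fst p = snd p} \<inter> space borel \<in> sets borel"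
    by (rule measurable_sets[of _ _ borel]) (auto intro!: borel_closed closed_Collect_eq continuous_intros)
  then show ?thesis by (simp add: vimage_def)
qed

text \<open>\<open>X\<close> is a Borel conull set on which the degree condition holds pointwise;
  neighbours of its points may still lie outside.\<close>

locale regular_pmp_graph = prob_space M for M :: "'a::polish_space measure" +
  fixes E :: "'a \<Rightarrow> 'a \<Rightarrow> bool" and d :: nat and X :: "'a set"
  assumes sets_M: "sets M = sets borel"
    and graph: "borel_graph E"
    and pmp: "pmp_graph M E"
    and X_borel[measurable]: "X \<in> sets borel" and X_conull: "- X \<in> null_sets M"
    and deg: "x \<in> X \<Longrightarrow> finite {y. E x y} \<and> card {y. E x y} = d"
begin

abbreviation nbh :: "'a \<Rightarrow> 'a set" where "nbh x \<equiv> {y. E x y}"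

lemma finite_nbh: "x \<in> X \<Longrightarrow> finite (nbh x)" and card_nbh: "x \<in> X \<Longrightarrow> card (nbh x) = d"
  using deg by auto

lemma E_sym: "E x y \<longleftrightarrow> E y x" and E_irrefl: "\<not> E x x"
  using graph by (auto simp: borel_graph_def simple_graph_def)

lemma space_M: "space M = UNIV"
  using sets_eq_imp_space_eq[OF sets_M] by simp

lemma measurable_M: "f \<in> measurable M N \<longleftrightarrow> f \<in> measurable borel N"
  using measurable_cong_sets[OF sets_M refl] by auto

sublocale compact_invariant M "conn_rel E"
proof
  show "sets M = sets borel" by (rule sets_M)
  have "symp E" using E_sym by (auto intro!: sympI)
  then have "sym {(x, y). E x y}" by (auto simp: sym_def dest: sympD)
  then show "sym (conn_rel E)" unfolding conn_rel_def by (rule sym_rtrancl)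
  show "trans (conn_rel E)" unfolding conn_rel_def by (rule trans_rtrancl)
next
  fix K f assume K: "compact K" "continuous_on K f" "inj_on f K" "\<forall>x\<in>K. (x, f x) \<in> conn_rel E"
  then have "partial_borel_bij f K"
    unfolding partial_borel_bij_def
    by (auto intro!: borel_compact compact_continuous_image borel_measurable_continuous_on_restrict)
  with K pmp show "measure M (f ` K) = measure M K" unfolding pmp_graph_def by blast
qed

text \<open>At degree \<open>d\<close>, any \<open>d\<close> distinct neighbours exhaust the
  neighbourhood; the coordinates of \<open>w\<close> from \<open>d\<close> on are free.\<close>

definition nbh_enum :: "('a \<times> (nat \<Rightarrow> 'a)) set" where
  "nbh_enum = {(x, w). x \<in> X \<and> inj_on w {..<d} \<and> (\<forall>i<d. E x (w i))}"

lemma nbh_enum_image: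
  assumes "(x, w) \<in> nbh_enum" shows "w ` {..<d} = nbh x"
  using assms finite_nbh card_nbh
  by (intro card_subset_eq) (auto simp: nbh_enum_def card_image)

lemma fst_nbh_enum: "fst ` nbh_enum = X"
proof (intro equalityI subsetI)
  fix x assume x: "x \<in> X"
  obtain w where "bij_betw w {0..<d} (nbh x)"
    using ex_bij_betw_nat_finite[OF finite_nbh[OF x]] card_nbh[OF x] by auto
  then have "(x, w) \<in> nbh_enum"
    using x by (auto simp: nbh_enum_def bij_betw_def lessThan_atLeast0)
  then show "x \<in> fst ` nbh_enum" by force
qed (auto simp: nbh_enum_def)

lemma nbh_enum_borel: "nbh_enum \<in> sets borel"
proof -
  have c: "continuous_on UNIV (\<lambda>z :: 'a \<times> (nat \<Rightarrow> 'a). snd z i)" for i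
    by (intro continuous_on_product_then_coordinatewise[of _ "\<lambda>z. snd z"] continuous_intros)
  have E_borel: "{(x, y). E x y} \<in> sets (borel :: ('a \<times> 'a) measure)"
    using graph unfolding borel_graph_def borel_prod by blast
  have "(\<lambda>z :: 'a \<times> (nat \<Rightarrow> 'a). (fst z, snd z i)) \<in> borel_measurable borel" for i
    by (intro borel_measurable_continuous_onI continuous_on_Pair continuous_on_fst continuous_on_id c)
  from measurable_sets[OF this E_borel]
  have e: "{z :: 'a \<times> (nat \<Rightarrow> 'a). E (fst z) (snd z i)} \<in> sets borel" for i
    by (simp add: vimage_def)
  have q: "{z :: 'a \<times> (nat \<Rightarrow> 'a). snd z i = snd z j} \<in> sets borel" for i j
    by (intro borel_closed closed_Collect_eq c)
  have x: "{z :: 'a \<times> (nat \<Rightarrow> 'a). fst z \<in> X} \<in> sets borel"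
    using measurable_sets[OF borel_measurable_continuous_onI[OF continuous_on_fst[OF continuous_on_id]] X_borel]
    by (simp add: vimage_def)
  have "nbh_enum = {z. fst z \<in> X} \<inter> (\<Inter>i\<in>{..<d}. \<Inter>j\<in>{..<d} - {i}. - {z. snd z i = snd z j})
      \<inter> (\<Inter>i\<in>{..<d}. {z. E (fst z) (snd z i)})"
    by (fastforce simp: nbh_enum_def inj_on_def)
  also have "\<dots> \<in> sets borel"
  proof -
    have "- {z :: 'a \<times> (nat \<Rightarrow> 'a). snd z i = snd z j} \<in> sets borel" for i j
      using q[of i j] by (rule borel_comp)
    moreover have "(\<Inter>i\<in>I. S i) \<in> sets borel"
      if "finite I" "\<And>i. i \<in> I \<Longrightarrow> S i \<in> sets borel" for I :: "nat set" and S :: "nat \<Rightarrow> ('a \<times> (nat \<Rightarrow> 'a)) set"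
      using that by (cases "I = {}") (auto intro: sets.finite_INT)
    ultimately show ?thesis using e x by (intro sets.Int) auto
  qed
  finally show ?thesis .
qed

lemma sum_nbh_enum:
  assumes "(x, w) \<in> nbh_enum" shows "sum f (nbh x) = (\<Sum>i<d. f (w i))"
  using assms by (simp add: nbh_enum_image[OF assms, symmetric] sum.reindex nbh_enum_def)

text \<open>Cut off outside \<open>X\<close>, where neighbourhoods may be infinite and
  \<open>adj_op\<close> need not be measurable.\<close>

definition adj :: "('a \<Rightarrow> real) \<Rightarrow> 'a \<Rightarrow> real" where
  "adj f x = (if x \<in> X then adj_op E f x else 0)"

text \<open>On \<open>nbh_enum\<close> the sum is a Borel function of \<open>w\<close> whose value
  depends on \<open>x\<close> alone, so its sublevel sets descend to \<open>X\<close>.\<close>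

lemma adj_measurable[measurable]:
  assumes f[measurable]: "f \<in> borel_measurable borel"
  shows "adj f \<in> borel_measurable borel"
proof (rule borel_measurableI_le)
  fix c
  have "{z \<in> nbh_enum. adj_op E f (fst z) \<le> c} = nbh_enum \<inter> {z. (\<Sum>i<d. f (snd z i)) \<le> c}"
    by (auto simp: adj_op_def sum_nbh_enum)
  also have "\<dots> \<in> sets borel"
  proof -
    have "continuous_on UNIV (\<lambda>z :: 'a \<times> (nat \<Rightarrow> 'a). snd z i)" for i
      by (intro continuous_on_product_then_coordinatewise[of _ "\<lambda>z. snd z"] continuous_intros)
    then have [measurable]: "(\<lambda>z :: 'a \<times> (nat \<Rightarrow> 'a). snd z i) \<in> borel_measurable borel" for i
      by (rule borel_measurable_continuous_onI)
    have "{z :: 'a \<times> (nat \<Rightarrow> 'a). (\<Sum>i<d. f (snd z i)) \<le> c} \<in> sets borel" by measurable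
    then show ?thesis using nbh_enum_borel by blast
  qed
  finally have "{x \<in> X. adj_op E f x \<le> c} \<in> sets borel"
    using borel_descend[of nbh_enum "\<lambda>x. adj_op E f x \<le> c"] nbh_enum_borel fst_nbh_enum by simp
  moreover have "{x. adj f x \<le> c} = {x \<in> X. adj_op E f x \<le> c} \<union> (if 0 \<le> c then - X else {})"
    by (auto simp: adj_def)
  ultimately show "{x \<in> space borel. adj f x \<le> c} \<in> sets borel" by auto
qed

lemma adj_indicator: "x \<in> X \<Longrightarrow> adj (indicator V) x = card (nbh x \<inter> V)"
  using finite_nbh[of x] by (simp add: adj_def adj_op_def indicator_def sum.If_cases Int_def)

lemma card_nbh_borel: 
  assumes [measurable]: "V \<in> sets borel" shows "{x \<in> X. card (nbh x \<inter> V) = k} \<in> sets borel"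
proof -
  have "{x \<in> X. card (nbh x \<inter> V) = k} = {x \<in> X. adj (indicator V) x = real k}"
    by (auto simp: adj_indicator)
  also have "\<dots> \<in> sets borel" by measurable
  finally show ?thesis .
qed

section \<open>Borel selection of single neighbours\<close>

definition uniq :: "'a set \<Rightarrow> 'a set" where
  "uniq V = {x \<in> X. card (nbh x \<inter> V) = 1}"

definition nbr :: "'a set \<Rightarrow> 'a \<Rightarrow> 'a" where
  "nbr V x = (if x \<in> uniq V then the_elem (nbh x \<inter> V) else undefined)"

lemma uniq_borel[measurable]: "V \<in> sets borel \<Longrightarrow> uniq V \<in> sets borel"
  unfolding uniq_def by (rule card_nbh_borel)

lemma nbr_eq:
  assumes "x \<in> uniq V" shows "nbh x \<inter> V = {nbr V x}"
proof -
  have "card (nbh x \<inter> V) = 1" using assms by (simp only: uniq_def mem_Collect_eq)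
  then obtain y where y: "nbh x \<inter> V = {y}" by (rule card_1_singletonE)
  have "nbr V x = the_elem (nbh x \<inter> V)" using assms by (simp only: nbr_def if_True)
  then show ?thesis unfolding y by simp
qed

lemma nbr_eqI: 
  assumes "x \<in> X" "nbh x \<inter> V = {y}" shows "x \<in> uniq V" "nbr V x = y"
proof -
  show "x \<in> uniq V" using assms by (simp add: uniq_def)
  from nbr_eq[OF this] show "nbr V x = y" using assms by auto
qed

lemma nbr_adj: "x \<in> uniq V \<Longrightarrow> E x (nbr V x)" and nbr_in: "x \<in> uniq V \<Longrightarrow> nbr V x \<in> V"
  using nbr_eq by auto

text \<open>On \<open>uniq V\<close> the selected neighbour lies in \<open>W\<close> exactly when
  \<open>V \<inter> W\<close> also contains one neighbour, which is a counting condition.\<close>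

lemma nbr_measurable[measurable]:
  assumes [measurable]: "V \<in> sets borel" shows "nbr V \<in> borel_measurable borel"
proof (rule measurableI)
  fix W :: "'a set" assume [measurable]: "W \<in> sets borel"
  have "nbr V -` W \<inter> space borel
      = (uniq V \<inter> {x \<in> X. card (nbh x \<inter> (V \<inter> W)) = 1}) \<union> (if undefined \<in> W then - uniq V else {})"
  proof (rule set_eqI)
    fix x
    show "x \<in> nbr V -` W \<inter> space borel \<longleftrightarrow>
       x \<in> (uniq V \<inter> {x \<in> X. card (nbh x \<inter> (V \<inter> W)) = 1}) \<union> (if undefined \<in> W then - uniq V else {})"
    proof (cases "x \<in> uniq V")
      case True
      have "nbh x \<inter> (V \<inter> W) = (nbh x \<inter> V) \<inter> W" by (rule Int_assoc[symmetric])
      then have "nbh x \<inter> (V \<inter> W) = (if nbr V x \<in> W then {nbr V x} else {})"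
        unfolding nbr_eq[OF True] by simp
      then show ?thesis using True by (auto simp: uniq_def)
    qed (auto simp: nbr_def)
  qed
  also have "\<dots> \<in> sets borel" using card_nbh_borel[of "V \<inter> W" 1] by auto
  finally show "nbr V -` W \<inter> space borel \<in> sets borel" .
qed simp

definition good :: "'a \<Rightarrow> bool" where "good x \<longleftrightarrow> x \<in> X \<and> nbh x \<subseteq> X"

text \<open>A neighbour \<open>y\<close> outside \<open>X\<close> is isolated by some
  \<open>base j\<close>. So \<open>x\<close> lies in the domain of the selection from
  \<open>base j - X\<close>, a map into a null set, and \<open>measure_into_null\<close> makes these
  countably many domains null.\<close>

lemma AE_good: "AE x in M. good x"
proof -
  have "measure M (uniq (base j - X)) = 0" for j
  proof (rule measure_into_null)
    show "(x, nbr (base j - X) x) \<in> conn_rel E" if "x \<in> uniq (base j - X)" for x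
      using nbr_adj[OF that] by (auto simp: conn_rel_def)
    show "nbr (base j - X) ` uniq (base j - X) \<subseteq> - X" using nbr_in by blast
  qed (use X_conull in auto)
  then have "uniq (base j - X) \<in> null_sets M" for j
    using uniq_borel[of "base j - X"] by (auto simp: null_sets_def emeasure_eq_measure sets_M)
  then have "(- X) \<union> (\<Union>j. uniq (base j - X)) \<in> null_sets M"
    using X_conull by (intro null_sets.Un null_sets_UN)
  then show ?thesis
  proof (rule AE_I')
    show "{x \<in> space M. \<not> good x} \<subseteq> (- X) \<union> (\<Union>j. uniq (base j - X))"
    proof
      fix x assume "x \<in> {x \<in> space M. \<not> good x}"
      then have "x \<notin> X \<or> (\<exists>y. E x y \<and> y \<notin> X \<and> x \<in> X)" by (auto simp: good_def)
      then show "x \<in> (- X) \<union> (\<Union>j. uniq (base j - X))"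
      proof
        assume "\<exists>y. E x y \<and> y \<notin> X \<and> x \<in> X"
        then obtain y where y: "E x y" "y \<notin> X" "x \<in> X" by blast
        obtain j where "y \<in> base j" "base j \<inter> nbh x \<subseteq> {y}" using base_isolate[OF finite_nbh[OF y(3)]] .
        then have "nbh x \<inter> (base j - X) = {y}" using y by auto
        from nbr_eqI(1)[OF y(3) this] show ?thesis by blast
      qed simp
    qed
  qed
qed

section \<open>Partial matchings along edges and mass transport\<close>

definition link :: "'a set \<Rightarrow> 'a set \<Rightarrow> 'a set" where
  "link V W = {x \<in> V \<inter> uniq W. nbr W x \<in> uniq V}"

lemma link_borel[measurable]:
  assumes "V \<in> sets borel" "W \<in> sets borel" shows "link V W \<in> sets borel"
proof -
  have "nbr W -` uniq V \<in> sets borel"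
    using measurable_sets[OF nbr_measurable[OF assms(2)] uniq_borel[OF assms(1)]] by simp
  moreover have "link V W = V \<inter> uniq W \<inter> nbr W -` uniq V" by (auto simp: link_def)
  ultimately show ?thesis using assms uniq_borel[OF assms(2)] by simp
qed

text \<open>Uniqueness is demanded at both ends of the edge, so the only neighbour of
  \<open>nbr W x\<close> in \<open>V\<close> is \<open>x\<close> itself.\<close>

lemma nbr_link:
  assumes "x \<in> link V W" shows "nbr W x \<in> link W V" "nbr V (nbr W x) = x"
proof -
  have x: "x \<in> V" "x \<in> uniq W" "nbr W x \<in> uniq V" using assms by (auto simp: link_def)
  have "x \<in> nbh (nbr W x) \<inter> V" using x nbr_adj[OF x(2)] E_sym by auto
  with nbr_eq[OF x(3)] show "nbr V (nbr W x) = x" by auto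
  with x show "nbr W x \<in> link W V" using nbr_in[OF x(2)] by (simp add: link_def)
qed

lemma link_sub:
  assumes "x \<in> link V W" shows "x \<in> X" "E x (nbr W x)"
proof -
  have x: "x \<in> uniq W" using assms by (simp add: link_def)
  from nbr_adj[OF this] show "E x (nbr W x)" .
  from x show "x \<in> X" by (simp add: uniq_def)
qed

text \<open>Because \<open>nbr V\<close> inverts \<open>nbr W\<close>, the image becomes a preimage
  under a Borel map; \<open>link_image_borel\<close> rests on this.\<close>

lemma link_image:
  assumes "B \<subseteq> link V W" shows "nbr W ` B = {y \<in> link W V. nbr V y \<in> B}"
proof (intro equalityI subsetI)
  fix y assume "y \<in> {y \<in> link W V. nbr V y \<in> B}"
  then have "nbr V y \<in> B" "nbr W (nbr V y) = y" using nbr_link(2)[of y W V] by simp_all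
  then show "y \<in> nbr W ` B" by (metis imageI)
next
  fix y assume "y \<in> nbr W ` B"
  then obtain x where x: "x \<in> B" "y = nbr W x" by blast
  with assms have "x \<in> link V W" by blast
  from nbr_link[OF this] x show "y \<in> {y \<in> link W V. nbr V y \<in> B}" by simp
qed

lemma link_image_borel:
  assumes "V \<in> sets borel" "W \<in> sets borel" "B \<in> sets borel" "B \<subseteq> link V W"
  shows "nbr W ` B \<in> sets borel"
proof -
  have "nbr V -` B \<in> sets borel" using measurable_sets[OF nbr_measurable[OF assms(1)] assms(3)] by simp
  moreover have "nbr W ` B = link W V \<inter> nbr V -` B" unfolding link_image[OF assms(4)] by blast
  ultimately show ?thesis using link_borel[OF assms(2,1)] by simp
qed

lemma link_measure:
  assumes "V \<in> sets borel" "W \<in> sets borel" "B \<in> sets borel" "B \<subseteq> link V W"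
  shows "emeasure M (nbr W ` B) = emeasure M B"
proof -
  have "inj_on (nbr W) B"
    by (rule inj_on_inverseI[where g = "nbr V"], rule nbr_link(2)[where W = W]) (use assms(4) in blast)
  then have "partial_borel_bij (nbr W) B"
    unfolding partial_borel_bij_def
    using assms(3) link_image_borel[OF assms] measurable_restrict_space1[OF nbr_measurable[OF assms(2)]]
    by blast
  moreover have "(x, nbr W x) \<in> conn_rel E" if "x \<in> B" for x
    using link_sub(2)[of x V W] that assms(4) unfolding conn_rel_def by blast
  ultimately have "measure M (nbr W ` B) = measure M B" using pmp unfolding pmp_graph_def by blast
  then show ?thesis by (simp add: emeasure_eq_measure)
qed

lemma nn_integral_link:
  assumes [measurable]: "V \<in> sets borel" "W \<in> sets borel" "B \<in> sets borel" and B: "B \<subseteq> link V W"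
    and h[measurable]: "h \<in> borel_measurable borel"
  shows "(\<integral>\<^sup>+x. indicator B x * h (nbr W x) \<partial>M) = (\<integral>\<^sup>+x. indicator (nbr W ` B) x * h x \<partial>M)"
proof -
  note [measurable] = link_image_borel[OF assms(1-4)]
  note [measurable_cong] = sets_M
  have eq: "distr (density M (indicator B)) borel (nbr W) = density M (indicator (nbr W ` B))"
  proof (rule measure_eqI)
    fix H assume "H \<in> sets (distr (density M (indicator B)) borel (nbr W))"
    then have H[measurable]: "H \<in> sets borel" by simp
    have v: "nbr W -` H \<in> sets borel" using measurable_sets[OF nbr_measurable H] assms by simp
    have "emeasure (distr (density M (indicator B)) borel (nbr W)) H = emeasure M (B \<inter> nbr W -` H)"
      using v by (simp add: emeasure_distr emeasure_restricted space_M sets_M assms)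
    also have "\<dots> = emeasure M (nbr W ` (B \<inter> nbr W -` H))"
      using v B by (intro link_measure[symmetric, of V W]) auto
    also have "nbr W ` (B \<inter> nbr W -` H) = nbr W ` B \<inter> H" by auto
    also have "emeasure M (nbr W ` B \<inter> H) = emeasure (density M (indicator (nbr W ` B))) H"
      using H link_image_borel[OF assms(1-4)] by (simp add: emeasure_restricted sets_M)
    finally show "emeasure (distr (density M (indicator B)) borel (nbr W)) H
        = emeasure (density M (indicator (nbr W ` B))) H" .
  qed (simp add: sets_M)
  have "(\<integral>\<^sup>+x. indicator B x * h (nbr W x) \<partial>M) = (\<integral>\<^sup>+x. h (nbr W x) \<partial>density M (indicator B))"
    by (subst nn_integral_density) auto
  also have "\<dots> = (\<integral>\<^sup>+x. h x \<partial>distr (density M (indicator B)) borel (nbr W))"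
    by (subst nn_integral_distr) auto
  also have "\<dots> = (\<integral>\<^sup>+x. indicator (nbr W ` B) x * h x \<partial>M)"
    unfolding eq by (subst nn_integral_density) auto
  finally show ?thesis .
qed

lemma edge_link:
  assumes "x \<in> X" "y \<in> X" "E x y"
  obtains i j where "x \<in> link (base i) (base j)" "nbr (base j) x = y"
proof -
  obtain i where i: "x \<in> base i" "base i \<inter> nbh y \<subseteq> {x}" using base_isolate[OF finite_nbh[OF assms(2)]] .
  obtain j where j: "y \<in> base j" "base j \<inter> nbh x \<subseteq> {y}" using base_isolate[OF finite_nbh[OF assms(1)]] .
  have "nbh x \<inter> base j = {y}" "nbh y \<inter> base i = {x}" using i j assms E_sym by auto
  then have "x \<in> uniq (base j)" "nbr (base j) x = y" "y \<in> uniq (base i)"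
    using nbr_eqI assms by blast+
  with i that show thesis by (auto simp: link_def)
qed

text \<open>Mass transport: the edges inside X are partitioned into the graphs of countably many
  partial bijections, and each of them preserves the measure.\<close>

lemma nn_integral_transport:
  assumes h[measurable]: "h \<in> borel_measurable borel"
  shows "(\<integral>\<^sup>+x. indicator X x * (\<Sum>y\<in>nbh x \<inter> X. h y) \<partial>M)
       = (\<integral>\<^sup>+y. indicator X y * of_nat (card (nbh y \<inter> X)) * h y \<partial>M)"
proof -
  define V W where "V n = (base (fst (prod_decode n)) :: 'a set)"
    and "W n = (base (snd (prod_decode n)) :: 'a set)" for n
  have [measurable]: "V n \<in> sets borel" "W n \<in> sets borel" for n by (simp_all add: V_def W_def)
  note [measurable_cong] = sets_M
  \<comment> \<open>Each directed edge is kept only at the first index that realizes it. A point may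
    lie in several \<open>B n\<close>, with different neighbours.\<close>
  define B where "B n = {x \<in> link (V n) (W n). \<forall>m<n. \<not> (x \<in> link (V m) (W m) \<and> nbr (W m) x = nbr (W n) x)}" for n
  have Bsub: "B n \<subseteq> link (V n) (W n)" for n by (auto simp: B_def)
  have Bb[measurable]: "B n \<in> sets borel" for n
  proof -
    have "B n = link (V n) (W n) - (\<Union>m\<in>{..<n}. link (V m) (W m) \<inter> {x. nbr (W m) x = nbr (W n) x})"
      by (auto simp: B_def)
    then show ?thesis by (auto intro!: sets.Diff sets.finite_UN sets.Int borel_Collect_eq)
  qed
  have Bex: "\<exists>n. x \<in> B n \<and> nbr (W n) x = y" if xy: "x \<in> X" "y \<in> X" "E x y" for x y
  proof -
    obtain i j where ij: "x \<in> link (base i) (base j)" "nbr (base j) x = y" using edge_link[OF xy] .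
    let ?P = "\<lambda>n. x \<in> link (V n) (W n) \<and> nbr (W n) x = y"
    have "?P (prod_encode (i, j))" using ij by (simp add: V_def W_def)
    then obtain n where n: "?P n" "\<forall>m<n. \<not> ?P m" using exists_least_iff[of ?P] by metis
    then have "x \<in> B n" unfolding B_def by blast
    with n show ?thesis by blast
  qed
  have Bun: "n = m" if "x \<in> B n" "x \<in> B m" "nbr (W n) x = nbr (W m) x" for x n m
    using that by (cases n m rule: linorder_cases) (auto simp: B_def)
  have BX: "x \<in> X" "nbr (W n) x \<in> X" "E x (nbr (W n) x)" if "x \<in> B n" for x n
    using that Bsub link_sub nbr_link(1) by blast+
  have out: "indicator X x * (\<Sum>y\<in>nbh x \<inter> X. h y) = (\<Sum>n. indicator (B n) x * h (nbr (W n) x))" for x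
  proof (cases "x \<in> X")
    case True
    have bij: "bij_betw (\<lambda>n. nbr (W n) x) {n. x \<in> B n} (nbh x \<inter> X)"
      unfolding bij_betw_def using Bun[of x] Bex[OF True] BX[of x] by (intro conjI inj_onI) (blast, blast)
    then have fin: "finite {n. x \<in> B n}" using finite_nbh[OF True] by (simp add: bij_betw_finite)
    have "(\<Sum>n. indicator (B n) x * h (nbr (W n) x)) = (\<Sum>n\<in>{n. x \<in> B n}. indicator (B n) x * h (nbr (W n) x))"
      by (rule suminf_finite[OF fin]) simp
    also have "\<dots> = (\<Sum>n\<in>{n. x \<in> B n}. h (nbr (W n) x))" by (intro sum.cong) auto
    also have "\<dots> = (\<Sum>y\<in>nbh x \<inter> X. h y)" by (rule sum.reindex_bij_betw[OF bij])
    finally show ?thesis using True by simp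
  next
    case False
    then have "x \<notin> B n" for n using BX(1) by blast
    with False show ?thesis by simp
  qed
  \<comment> \<open>The indices whose image contains \<open>y\<close> correspond to the edges
    entering \<open>y\<close> from \<open>X\<close>, through their starting points
    \<open>nbr (V n) y\<close>.\<close>
  have into: "(\<Sum>n. indicator (nbr (W n) ` B n) y) = (indicator X y * of_nat (card (nbh y \<inter> X)) :: ennreal)" for y
  proof (cases "y \<in> X")
    case True
    have im: "y \<in> nbr (W n) ` B n \<longleftrightarrow> y \<in> link (W n) (V n) \<and> nbr (V n) y \<in> B n" for n
      using link_image[OF Bsub[of n]] by auto
    have "nbr (V n) y \<in> nbh y \<inter> X" if "y \<in> nbr (W n) ` B n" for n
      using that im[of n] link_sub(2)[of y "W n" "V n"] BX(1) by blast
    moreover have "\<exists>n. y \<in> nbr (W n) ` B n \<and> nbr (V n) y = x" if x: "x \<in> nbh y \<inter> X" for x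
    proof -
      obtain n where "x \<in> B n" "nbr (W n) x = y" using Bex[of x y] x True E_sym by auto
      then show ?thesis using nbr_link(2)[of x "V n" "W n"] Bsub[of n] by blast
    qed
    moreover have "n = m" if "y \<in> nbr (W n) ` B n" "y \<in> nbr (W m) ` B m" "nbr (V n) y = nbr (V m) y" for n m
    proof (rule Bun)
      show "nbr (V n) y \<in> B n" "nbr (V n) y \<in> B m" using that im by auto
      show "nbr (W n) (nbr (V n) y) = nbr (W m) (nbr (V n) y)"
        using that im nbr_link(2) by metis
    qed
    ultimately have bij: "bij_betw (\<lambda>n. nbr (V n) y) {n. y \<in> nbr (W n) ` B n} (nbh y \<inter> X)"
      unfolding bij_betw_def by (intro conjI inj_onI) blast+
    then have fin: "finite {n. y \<in> nbr (W n) ` B n}" using finite_nbh[OF True] by (simp add: bij_betw_finite)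
    have "(\<Sum>n. indicator (nbr (W n) ` B n) y :: ennreal) = (\<Sum>n\<in>{n. y \<in> nbr (W n) ` B n}. indicator (nbr (W n) ` B n) y)"
      by (rule suminf_finite[OF fin]) simp
    also have "\<dots> = of_nat (card {n. y \<in> nbr (W n) ` B n})" by simp
    also have "card {n. y \<in> nbr (W n) ` B n} = card (nbh y \<inter> X)" using bij by (rule bij_betw_same_card)
    finally show ?thesis using True by simp
  next
    case False
    then have "y \<notin> nbr (W n) ` B n" for n using BX(2) by blast
    with False show ?thesis by simp
  qed
  have im_b[measurable]: "nbr (W n) ` B n \<in> sets borel" for n by (rule link_image_borel[of "V n"]) (auto simp: Bsub)
  have "(\<integral>\<^sup>+x. indicator X x * (\<Sum>y\<in>nbh x \<inter> X. h y) \<partial>M) = (\<Sum>n. \<integral>\<^sup>+x. indicator (B n) x * h (nbr (W n) x) \<partial>M)"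
    unfolding out by (intro nn_integral_suminf) measurable
  also have "\<dots> = (\<Sum>n. \<integral>\<^sup>+y. indicator (nbr (W n) ` B n) y * h y \<partial>M)"
    by (intro suminf_cong nn_integral_link[OF _ _ _ Bsub]) auto
  also have "\<dots> = (\<integral>\<^sup>+y. (\<Sum>n. indicator (nbr (W n) ` B n) y * h y) \<partial>M)"
    by (intro nn_integral_suminf[symmetric]) measurable
  also have "\<dots> = (\<integral>\<^sup>+y. (\<Sum>n. indicator (nbr (W n) ` B n) y) * h y \<partial>M)"
    by (simp add: ennreal_suminf_multc)
  finally show ?thesis unfolding into .
qed

end

section \<open>Rayleigh quotients and independent sets\<close>

text \<open>Outside X the operator T need not produce measurable functions, and the integral of a
  nonmeasurable function is 0 by convention; this can only add the quotient 0.\<close>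

lemma rayleigh_quotients_null_change:
  assumes sets: "sets M = sets borel" and X: "X \<in> sets borel"
    and meas: "\<And>f. f \<in> borel_measurable borel \<Longrightarrow> T' f \<in> borel_measurable borel"
    and on_X: "\<And>f x. x \<in> X \<Longrightarrow> T f x = T' f x"
    and loc: "AE x in M. x \<in> X \<and> (\<forall>f. T' (\<lambda>x. f x * indicator X x) x = T' f x)"
  shows "rayleigh_quotients M T' \<subseteq> rayleigh_quotients M T"
    and "rayleigh_quotients M T \<subseteq> insert 0 (rayleigh_quotients M T')"
proof -
  have mb: "f \<in> borel_measurable M \<longleftrightarrow> f \<in> borel_measurable borel" for f :: "'a \<Rightarrow> real"
    using measurable_cong_sets[OF sets refl] by auto
  have aeX: "AE x in M. x \<in> X" using loc by auto
  show "rayleigh_quotients M T' \<subseteq> rayleigh_quotients M T"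
  proof
    fix q assume "q \<in> rayleigh_quotients M T'"
    then obtain f where f: "f \<in> borel_measurable borel" "integrable M (\<lambda>x. (f x)\<^sup>2)" "(\<integral>x. (f x)\<^sup>2 \<partial>M) \<noteq> 0"
      "q = (\<integral>x. T' f x * f x \<partial>M) / (\<integral>x. (f x)\<^sup>2 \<partial>M)"
      unfolding rayleigh_quotients_def mb by blast
    \<comment> \<open>With \<open>f\<close> cut off, the factor \<open>g x\<close> vanishes outside
      \<open>X\<close>, so the integrands for \<open>T\<close> and \<open>T'\<close> agree
      everywhere and measurability is inherited from \<open>T'\<close>.\<close>
    define g where "g = (\<lambda>x. f x * indicator X x)"
    have g: "g \<in> borel_measurable borel" using f(1) X unfolding g_def by measurable
    have eq: "T g x * g x = T' g x * g x" for x by (cases "x \<in> X") (simp_all add: on_X g_def)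
    have ae1: "AE x in M. (f x)\<^sup>2 = (g x)\<^sup>2" using aeX by eventually_elim (simp add: g_def)
    have ae2: "AE x in M. T' f x * f x = T' g x * g x" using loc by eventually_elim (simp add: g_def)
    have m: "(\<lambda>x. (f x)\<^sup>2) \<in> borel_measurable M" "(\<lambda>x. (g x)\<^sup>2) \<in> borel_measurable M"
      "(\<lambda>x. T' f x * f x) \<in> borel_measurable M" "(\<lambda>x. T' g x * g x) \<in> borel_measurable M"
      unfolding mb using f(1) g meas[OF f(1)] meas[OF g] by measurable
    have "integrable M (\<lambda>x. (g x)\<^sup>2)" using f(2) integrable_cong_AE[OF m(1,2) ae1] by simp
    moreover have "(\<integral>x. (f x)\<^sup>2 \<partial>M) = (\<integral>x. (g x)\<^sup>2 \<partial>M)" using integral_cong_AE[OF m(1,2) ae1] .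
    moreover have "(\<integral>x. T' f x * f x \<partial>M) = (\<integral>x. T g x * g x \<partial>M)"
      using integral_cong_AE[OF m(3,4) ae2] by (simp add: eq)
    ultimately show "q \<in> rayleigh_quotients M T"
      using f g unfolding rayleigh_quotients_def mb by auto
  qed
  show "rayleigh_quotients M T \<subseteq> insert 0 (rayleigh_quotients M T')"
  proof
    fix q assume "q \<in> rayleigh_quotients M T"
    then obtain f where f: "f \<in> borel_measurable borel" "integrable M (\<lambda>x. (f x)\<^sup>2)" "(\<integral>x. (f x)\<^sup>2 \<partial>M) \<noteq> 0"
      "q = (\<integral>x. T f x * f x \<partial>M) / (\<integral>x. (f x)\<^sup>2 \<partial>M)"
      unfolding rayleigh_quotients_def mb by blast
    show "q \<in> insert 0 (rayleigh_quotients M T')"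
    proof (cases "(\<lambda>x. T f x * f x) \<in> borel_measurable M")
      case True
      moreover have "(\<lambda>x. T' f x * f x) \<in> borel_measurable M"
        unfolding mb using f(1) meas[OF f(1)] by measurable
      moreover have "AE x in M. T f x * f x = T' f x * f x"
        using aeX by eventually_elim (simp add: on_X)
      ultimately have "(\<integral>x. T f x * f x \<partial>M) = (\<integral>x. T' f x * f x \<partial>M)" by (rule integral_cong_AE)
      then show ?thesis using f unfolding rayleigh_quotients_def mb by auto
    next
      case False
      then have "\<not> integrable M (\<lambda>x. T f x * f x)" using borel_measurable_integrable by blast
      then show ?thesis using f(4) by (simp add: not_integrable_integral_eq)
    qed
  qed
qed

section \<open>Norm bound and test functions for the adjacency operator\<close>

context regular_pmp_graph
begin

lemma adj_eq: "x \<in> X \<Longrightarrow> adj f x = (\<Sum>y\<in>nbh x. f y)"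
  by (simp add: adj_def adj_op_def)

text \<open>By transport each \<open>h y\<close> is counted once per neighbour of \<open>y\<close>
  in \<open>X\<close>; at good points there are \<open>d\<close> of these.\<close>

lemma nn_integral_adj:
  fixes h :: "'a \<Rightarrow> real"
  assumes h: "h \<in> borel_measurable borel" and nonneg: "\<And>x. 0 \<le> h x"
  shows "(\<integral>\<^sup>+x. ennreal (adj h x) \<partial>M) = of_nat d * (\<integral>\<^sup>+x. ennreal (h x) \<partial>M)"
proof -
  have hM: "h \<in> borel_measurable M" using h by (simp add: measurable_M)
  have "(\<integral>\<^sup>+x. ennreal (adj h x) \<partial>M) = (\<integral>\<^sup>+x. indicator X x * (\<Sum>y\<in>nbh x \<inter> X. ennreal (h y)) \<partial>M)"
  proof (rule nn_integral_cong_AE)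
    show "AE x in M. ennreal (adj h x) = indicator X x * (\<Sum>y\<in>nbh x \<inter> X. ennreal (h y))"
      using AE_good
    proof eventually_elim
      case (elim x)
      then have "x \<in> X" "nbh x \<inter> X = nbh x" by (auto simp: good_def)
      then show ?case using nonneg by (simp add: adj_eq sum_ennreal)
    qed
  qed
  also have "\<dots> = (\<integral>\<^sup>+y. indicator X y * of_nat (card (nbh y \<inter> X)) * ennreal (h y) \<partial>M)"
    using h by (intro nn_integral_transport) simp
  also have "\<dots> = (\<integral>\<^sup>+y. of_nat d * ennreal (h y) \<partial>M)"
  proof (rule nn_integral_cong_AE)
    show "AE y in M. indicator X y * of_nat (card (nbh y \<inter> X)) * ennreal (h y) = of_nat d * ennreal (h y)"
      using AE_good
    proof eventually_elim
      case (elim x)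
      then have "x \<in> X" "nbh x \<inter> X = nbh x" by (auto simp: good_def)
      then show ?case by (simp add: card_nbh)
    qed
  qed
  also have "\<dots> = of_nat d * (\<integral>\<^sup>+x. ennreal (h x) \<partial>M)"
    using hM by (intro nn_integral_cmult) simp
  finally show ?thesis .
qed

lemma adj_nonneg: "(\<And>x. 0 \<le> h x) \<Longrightarrow> 0 \<le> adj h x"
  by (auto simp: adj_def adj_op_def intro: sum_nonneg)

lemma integral_adj:
  fixes h :: "'a \<Rightarrow> real"
  assumes h: "h \<in> borel_measurable borel" "integrable M h" and nonneg: "\<And>x. 0 \<le> h x"
  shows "integrable M (adj h)" "(\<integral>x. adj h x \<partial>M) = d * (\<integral>x. h x \<partial>M)"
proof -
  have eq: "(\<integral>\<^sup>+x. ennreal (adj h x) \<partial>M) = ennreal (d * (\<integral>x. h x \<partial>M))"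
    using nn_integral_eq_integral[OF h(2)] nonneg
    by (simp add: nn_integral_adj[OF h(1) nonneg] ennreal_mult ennreal_of_nat_eq_real_of_nat integral_nonneg_AE)
  show i: "integrable M (adj h)"
    using adj_measurable[OF h(1)] adj_nonneg[of h] nonneg eq
    by (intro integrableI_nonneg) (auto simp: measurable_M)
  have "ennreal (\<integral>x. adj h x \<partial>M) = ennreal (d * (\<integral>x. h x \<partial>M))"
    using nn_integral_eq_integral[OF i] adj_nonneg[of h] nonneg eq by simp
  then show "(\<integral>x. adj h x \<partial>M) = d * (\<integral>x. h x \<partial>M)"
    using adj_nonneg[of h] nonneg by (simp add: integral_nonneg_AE)
qed

text \<open>The inequality \<open>2 * a * b \<le> a^2 + b^2\<close> on each edge leaves a majorant
  whose integral is known, since \<open>adj\<close> multiplies integrals by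
  \<open>d\<close>.\<close>

lemma adj_form_bound:
  fixes f :: "'a \<Rightarrow> real"
  assumes "x \<in> X"
  shows "\<bar>adj f x * f x\<bar> \<le> (adj (\<lambda>y. (f y)\<^sup>2) x + d * (f x)\<^sup>2) / 2"
proof -
  have "\<bar>adj f x * f x\<bar> = \<bar>\<Sum>y\<in>nbh x. f y * f x\<bar>" using assms by (simp add: adj_eq sum_distrib_right)
  also have "\<dots> \<le> (\<Sum>y\<in>nbh x. \<bar>f y * f x\<bar>)" by (rule sum_abs)
  also have "\<dots> \<le> (\<Sum>y\<in>nbh x. ((f y)\<^sup>2 + (f x)\<^sup>2) / 2)"
  proof (rule sum_mono)
    fix y
    have "0 \<le> (\<bar>f y\<bar> - \<bar>f x\<bar>)\<^sup>2" by simp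
    then show "\<bar>f y * f x\<bar> \<le> ((f y)\<^sup>2 + (f x)\<^sup>2) / 2"
      by (simp add: power2_diff abs_mult)
  qed
  also have "\<dots> = (adj (\<lambda>y. (f y)\<^sup>2) x + d * (f x)\<^sup>2) / 2"
    using assms card_nbh[OF assms] by (simp add: adj_eq sum_divide_distrib[symmetric] sum.distrib)
  finally show ?thesis .
qed

lemma adj_form:
  fixes f :: "'a \<Rightarrow> real"
  assumes f: "f \<in> borel_measurable borel" "integrable M (\<lambda>x. (f x)\<^sup>2)"
  shows "integrable M (\<lambda>x. adj f x * f x)"
    and "\<bar>\<integral>x. adj f x * f x \<partial>M\<bar> \<le> d * (\<integral>x. (f x)\<^sup>2 \<partial>M)"
proof -
  let ?b = "\<lambda>x. (adj (\<lambda>y. (f y)\<^sup>2) x + d * (f x)\<^sup>2) / 2"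
  have fm: "(\<lambda>x. (f x)\<^sup>2) \<in> borel_measurable borel" using f(1) by measurable
  note a = integral_adj[OF fm f(2) zero_le_power2]
  have b: "integrable M ?b" using a(1) f(2) by auto
  have m: "(\<lambda>x. adj f x * f x) \<in> borel_measurable M"
    using f(1) adj_measurable[OF f(1)] by (simp add: measurable_M)
  have ae: "AE x in M. \<bar>adj f x * f x\<bar> \<le> ?b x"
    using AE_good by eventually_elim (rule adj_form_bound, simp add: good_def)
  show i: "integrable M (\<lambda>x. adj f x * f x)"
    by (rule Bochner_Integration.integrable_bound[OF b m]) (use ae in eventually_elim, auto)
  have "\<bar>\<integral>x. adj f x * f x \<partial>M\<bar> \<le> (\<integral>x. \<bar>adj f x * f x\<bar> \<partial>M)" by (rule integral_abs_bound)
  also have "\<dots> \<le> (\<integral>x. ?b x \<partial>M)" using i b ae by (intro integral_mono_AE) auto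
  also have "\<dots> = d * (\<integral>x. (f x)\<^sup>2 \<partial>M)" using a f(2) by simp
  finally show "\<bar>\<integral>x. adj f x * f x \<partial>M\<bar> \<le> d * (\<integral>x. (f x)\<^sup>2 \<partial>M)" .
qed

lemma rayleigh_adj_ge:
  assumes "q \<in> rayleigh_quotients M adj" shows "- real d \<le> q"
proof -
  obtain f where f: "f \<in> borel_measurable borel" "integrable M (\<lambda>x. (f x)\<^sup>2)" "(\<integral>x. (f x)\<^sup>2 \<partial>M) \<noteq> 0"
    "q = (\<integral>x. adj f x * f x \<partial>M) / (\<integral>x. (f x)\<^sup>2 \<partial>M)"
    using assms unfolding rayleigh_quotients_def measurable_M by blast
  have "(\<integral>x. (f x)\<^sup>2 \<partial>M) > 0" using f(3) by (simp add: less_le)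
  then show ?thesis using adj_form(2)[OF f(1,2)] by (simp add: f(4) field_simps abs_le_iff)
qed

lemma bdd_below_rayleigh_adj: "bdd_below (rayleigh_quotients M adj)"
  using rayleigh_adj_ge by (rule bdd_belowI)

lemma Inf_rayleigh_adj_le:
  fixes f :: "'a \<Rightarrow> real"
  assumes "f \<in> borel_measurable borel" "integrable M (\<lambda>x. (f x)\<^sup>2)"
  shows "Inf (rayleigh_quotients M adj) * (\<integral>x. (f x)\<^sup>2 \<partial>M) \<le> (\<integral>x. adj f x * f x \<partial>M)"
proof (cases "(\<integral>x. (f x)\<^sup>2 \<partial>M) = 0")
  case True
  \<comment> \<open>At norm zero the norm bound forces the form to vanish.\<close>
  then show ?thesis using adj_form(2)[OF assms] by simp
next
  case False
  then have pos: "(\<integral>x. (f x)\<^sup>2 \<partial>M) > 0" by (simp add: less_le)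
  have "(\<integral>x. adj f x * f x \<partial>M) / (\<integral>x. (f x)\<^sup>2 \<partial>M) \<in> rayleigh_quotients M adj"
    using False assms unfolding rayleigh_quotients_def measurable_M by blast
  from cInf_lower[OF this bdd_below_rayleigh_adj] show ?thesis
    unfolding pos_le_divide_eq[OF pos] .
qed

text \<open>The test function of Hoffman's argument is the centred indicator of the independent set.\<close>

lemma indep_form:
  assumes S[measurable]: "S \<in> sets borel" and indep: "independent_set E S"
  defines "f \<equiv> \<lambda>x. indicator S x - measure M S"
  shows "f \<in> borel_measurable borel" "integrable M (\<lambda>x. (f x)\<^sup>2)"
    and "(\<integral>x. (f x)\<^sup>2 \<partial>M) = measure M S - (measure M S)\<^sup>2"
    and "(\<integral>x. adj f x * f x \<partial>M) = - d * (measure M S)\<^sup>2"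
proof -
  let ?s = "measure M S" and ?I = "indicator S :: 'a \<Rightarrow> real"
  show f: "f \<in> borel_measurable borel" unfolding f_def by measurable
  have SM: "S \<in> sets M" using S by (simp add: sets_M)
  have iI: "integrable M ?I" using SM by (simp add: emeasure_eq_measure)
  have II: "(\<integral>x. ?I x \<partial>M) = ?s" using SM by simp
  have Im: "?I \<in> borel_measurable borel" by measurable
  note a = integral_adj[OF Im iI indicator_pos_le]
  have sq: "(f x)\<^sup>2 = ?I x - 2 * ?s * ?I x + ?s\<^sup>2" for x
    by (cases "x \<in> S") (simp_all add: f_def power2_eq_square algebra_simps)
  show "integrable M (\<lambda>x. (f x)\<^sup>2)" unfolding sq using iI by auto
  have "(\<integral>x. (f x)\<^sup>2 \<partial>M) = ?s - 2 * ?s * ?s + ?s\<^sup>2"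
    unfolding sq using iI II by (simp add: prob_space)
  then show "(\<integral>x. (f x)\<^sup>2 \<partial>M) = ?s - ?s\<^sup>2" by (simp add: power2_eq_square)
  have "adj f x * f x = - ?s * adj ?I x - ?s * d * ?I x + ?s\<^sup>2 * d" if "x \<in> X" for x
  proof -
    have "adj f x = adj ?I x - d * ?s"
      using that card_nbh[OF that] by (simp add: adj_eq f_def sum_subtractf)
    moreover have "f x = ?I x - ?s" by (simp add: f_def)
    ultimately have "adj f x * f x = (adj ?I x - d * ?s) * (?I x - ?s)" by (simp only:)
    also have "\<dots> = adj ?I x * ?I x - ?s * adj ?I x - ?s * d * ?I x + ?s\<^sup>2 * d"
      by (simp add: power2_eq_square algebra_simps)
    finally have "adj f x * f x = adj ?I x * ?I x - ?s * adj ?I x - ?s * d * ?I x + ?s\<^sup>2 * d" .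
    \<comment> \<open>Independence enters here: a point of \<open>S\<close> has no neighbour in
      \<open>S\<close>.\<close>
    moreover have "adj ?I x * ?I x = 0"
    proof (cases "x \<in> S")
      case True
      then have "nbh x \<inter> S = {}" using indep by (auto simp: independent_set_def)
      then show ?thesis using that by (simp add: adj_indicator)
    qed simp
    ultimately show ?thesis by simp
  qed
  then have "AE x in M. adj f x * f x = - ?s * adj ?I x - ?s * d * ?I x + ?s\<^sup>2 * d"
    using AE_good by (auto simp: good_def)
  then have "(\<integral>x. adj f x * f x \<partial>M) = (\<integral>x. - ?s * adj ?I x - ?s * d * ?I x + ?s\<^sup>2 * d \<partial>M)"
    using f Im adj_measurable[OF f] adj_measurable[OF Im]
    by (intro integral_cong_AE) (auto simp: measurable_M)
  also have "\<dots> = - ?s * (d * ?s) - ?s * d * ?s + ?s\<^sup>2 * d"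
    using a iI II by (simp add: prob_space)
  also have "\<dots> = - d * ?s\<^sup>2" by (simp add: power2_eq_square)
  finally show "(\<integral>x. adj f x * f x \<partial>M) = - d * ?s\<^sup>2" .
qed

text \<open>Writing s for \<open>measure M S\<close>, the second claim comes from the norm bound,
  \<open>d * s^2 \<le> d * (s - s^2)\<close>. It keeps s away from 1, so that the test function is
  nonzero when s is positive.\<close>

lemma indep_measure:
  assumes "S \<in> sets borel" "independent_set E S"
  shows "Inf (rayleigh_quotients M adj) * (measure M S - (measure M S)\<^sup>2) \<le> - d * (measure M S)\<^sup>2"
    and "1 \<le> d \<Longrightarrow> measure M S \<le> 1/2"
proof -
  note f = indep_form[OF assms]
  show "Inf (rayleigh_quotients M adj) * (measure M S - (measure M S)\<^sup>2) \<le> - d * (measure M S)\<^sup>2"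
    using Inf_rayleigh_adj_le[OF f(1,2)] by (simp add: f(3,4))
  assume "1 \<le> d"
  have "d * (measure M S)\<^sup>2 \<le> d * (measure M S - (measure M S)\<^sup>2)"
    using adj_form(2)[OF f(1,2)] by (simp add: f(3,4))
  with \<open>1 \<le> d\<close> have "2 * (measure M S)\<^sup>2 \<le> measure M S" by simp
  then show "measure M S \<le> 1/2"
    using measure_nonneg[of M S] by (cases "measure M S = 0") (auto simp: power2_eq_square)
qed

text \<open>The points of \<open>base n\<close> without neighbours in \<open>base n\<close> are
  independent, and these sets cover \<open>X\<close> because each point can be isolated from its
  finitely many neighbours. One of them must have positive measure.\<close>

lemma ex_indep_pos: "\<exists>S\<in>sets borel. independent_set E S \<and> measure M S > 0"
proof (rule ccontr)
  assume neg: "\<not> ?thesis"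
  define S where "S n = {x \<in> X. card (nbh x \<inter> base n) = 0} \<inter> base n" for n
  have Sb: "S n \<in> sets borel" for n
    unfolding S_def using card_nbh_borel[of "base n" 0] by auto
  have "independent_set E (S n)" for n
    unfolding independent_set_def
  proof (intro ballI notI)
    fix x y assume "x \<in> S n" "y \<in> S n" "E x y"
    then have "y \<in> nbh x \<inter> base n" "card (nbh x \<inter> base n) = 0" "x \<in> X" unfolding S_def by blast+
    then show False using finite_nbh[of x] card_0_eq[of "nbh x \<inter> base n"] by blast
  qed
  then have "S n \<in> null_sets M" for n
    using neg Sb[of n] measure_nonneg[of M "S n"]
    by (auto simp: null_sets_def sets_M emeasure_eq_measure not_less intro: antisym)
  then have "(- X) \<union> (\<Union>n. S n) \<in> null_sets M"
    using X_conull by (intro null_sets.Un null_sets_UN)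
  moreover have "(- X) \<union> (\<Union>n. S n) = space M"
  proof -
    have "\<exists>n. x \<in> S n" if x: "x \<in> X" for x
    proof -
      obtain n where n: "x \<in> base n" "base n \<inter> nbh x \<subseteq> {x}" using base_isolate[OF finite_nbh[OF x]] .
      then have "nbh x \<inter> base n = {}" using E_irrefl[of x] by blast
      then have "card (nbh x \<inter> base n) = 0" by (simp only: card.empty)
      then show ?thesis using n(1) x unfolding S_def by blast
    qed
    then show ?thesis unfolding space_M by blast
  qed
  ultimately show False using emeasure_space_1 by (auto simp: null_sets_def)
qed

lemma Inf_rayleigh_adj_neg:
  assumes "1 \<le> d"
  shows "Inf (rayleigh_quotients M adj) < 0" "rayleigh_quotients M adj \<noteq> {}"
proof -
  obtain S where S: "S \<in> sets borel" "independent_set E S" "measure M S > 0" using ex_indep_pos by blast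
  let ?s = "measure M S"
  have "?s * ?s \<le> ?s * (1/2)" using indep_measure(2)[OF S(1,2) assms] by (intro mult_left_mono) auto
  then have pos: "?s - ?s\<^sup>2 > 0" using S(3) by (simp add: power2_eq_square)
  have "- d * ?s\<^sup>2 < 0" using S(3) assms by simp
  with indep_measure(1)[OF S(1,2)] have "Inf (rayleigh_quotients M adj) * (?s - ?s\<^sup>2) < 0" by linarith
  with pos show "Inf (rayleigh_quotients M adj) < 0" by (simp add: mult_less_0_iff)
  show "rayleigh_quotients M adj \<noteq> {}"
    using indep_form[OF S(1,2)] pos unfolding rayleigh_quotients_def measurable_M by force
qed

section \<open>The Laplacian and the return to the given operators\<close>

definition lap :: "('a \<Rightarrow> real) \<Rightarrow> 'a \<Rightarrow> real" where
  "lap f x = real d * (f x * indicator X x) - adj f x"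

lemma adj_local:
  fixes f :: "'a \<Rightarrow> real"
  shows "good x \<Longrightarrow> adj (\<lambda>x. f x * indicator X x) x = adj f x"
  by (auto simp: good_def adj_eq intro!: sum.cong)

text \<open>By regularity the Laplacian is almost everywhere \<open>d\<close> times the identity
  minus the adjacency operator.\<close>

lemma rayleigh_lap: "rayleigh_quotients M lap = (\<lambda>q. d - q) ` rayleigh_quotients M adj"
proof -
  define \<F> where "\<F> = {f :: 'a \<Rightarrow> real. f \<in> borel_measurable borel \<and> integrable M (\<lambda>x. (f x)\<^sup>2)
    \<and> (\<integral>x. (f x)\<^sup>2 \<partial>M) \<noteq> 0}"
  have rq: "rayleigh_quotients M T = (\<lambda>f. (\<integral>x. T f x * f x \<partial>M) / (\<integral>x. (f x)\<^sup>2 \<partial>M)) ` \<F>" for T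
    unfolding rayleigh_quotients_def measurable_M \<F>_def by blast
  have "(\<integral>x. lap f x * f x \<partial>M) / (\<integral>x. (f x)\<^sup>2 \<partial>M) = d - (\<integral>x. adj f x * f x \<partial>M) / (\<integral>x. (f x)\<^sup>2 \<partial>M)"
    if f: "f \<in> borel_measurable borel" "integrable M (\<lambda>x. (f x)\<^sup>2)" "(\<integral>x. (f x)\<^sup>2 \<partial>M) \<noteq> 0" for f
  proof -
    have "(\<integral>x. lap f x * f x \<partial>M) = (\<integral>x. d * (f x)\<^sup>2 - adj f x * f x \<partial>M)"
    proof (rule integral_cong_AE)
      have "lap f \<in> borel_measurable borel" unfolding lap_def using f(1) by measurable
      then show "(\<lambda>x. lap f x * f x) \<in> borel_measurable M"
        "(\<lambda>x. d * (f x)\<^sup>2 - adj f x * f x) \<in> borel_measurable M"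
        using f(1) adj_measurable[OF f(1)] by (auto simp: measurable_M)
      show "AE x in M. lap f x * f x = d * (f x)\<^sup>2 - adj f x * f x"
        using AE_good by eventually_elim (simp add: lap_def good_def power2_eq_square algebra_simps)
    qed
    also have "\<dots> = d * (\<integral>x. (f x)\<^sup>2 \<partial>M) - (\<integral>x. adj f x * f x \<partial>M)"
      using f(2) adj_form(1)[OF f(1,2)] by simp
    finally show ?thesis using f(3) by (simp add: field_simps)
  qed
  then show ?thesis unfolding rq image_image by (intro image_cong refl) (simp add: \<F>_def)
qed

lemma m_op_adj:
  assumes "1 \<le> d" shows "m_op M (adj_op E) = Inf (rayleigh_quotients M adj)"
proof -
  let ?R = "rayleigh_quotients M adj" and ?R' = "rayleigh_quotients M (adj_op E)"
  have sub: "?R \<subseteq> ?R'" "?R' \<subseteq> insert 0 ?R"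
  proof -
    have ae: "AE x in M. x \<in> X \<and> (\<forall>f. adj (\<lambda>x. f x * indicator X x) x = adj f x)"
      using AE_good by eventually_elim (auto simp: adj_local good_def)
    have "adj_op E f x = adj f x" if "x \<in> X" for f x using that by (simp add: adj_def)
    from rayleigh_quotients_null_change[OF sets_M X_borel adj_measurable this ae]
    show "?R \<subseteq> ?R'" "?R' \<subseteq> insert 0 ?R" by simp_all
  qed
  note neg = Inf_rayleigh_adj_neg[OF assms]
  \<comment> \<open>The possible extra quotient 0 lies above the negative infimum.\<close>
  have low: "Inf ?R \<le> q" if "q \<in> ?R'" for q
    using that sub(2) neg(1) cInf_lower[OF _ bdd_below_rayleigh_adj] by fastforce
  have "Inf ?R' \<le> Inf ?R" by (rule cInf_superset_mono[OF neg(2) bdd_belowI[OF low] sub(1)])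
  moreover have "Inf ?R \<le> Inf ?R'" using low neg(2) sub(1) by (intro cInf_greatest) auto
  ultimately show ?thesis by (simp add: m_op_def)
qed

lemma M_op_lap:
  assumes "1 \<le> d" shows "M_op M (lap_op E) = d - Inf (rayleigh_quotients M adj)"
proof -
  let ?R = "rayleigh_quotients M adj" and ?R' = "rayleigh_quotients M (lap_op E)"
  have sub: "(\<lambda>q. d - q) ` ?R \<subseteq> ?R'" "?R' \<subseteq> insert 0 ((\<lambda>q. d - q) ` ?R)"
  proof -
    have ae: "AE x in M. x \<in> X \<and> (\<forall>f. lap (\<lambda>x. f x * indicator X x) x = lap f x)"
      using AE_good by eventually_elim (auto simp: adj_local good_def lap_def)
    have m: "lap f \<in> borel_measurable borel" if "f \<in> borel_measurable borel" for f
      unfolding lap_def using that by measurable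
    have "lap_op E f x = lap f x" if "x \<in> X" for f x
      using that by (simp add: lap_op_def lap_def adj_eq card_nbh)
    from rayleigh_quotients_null_change[OF sets_M X_borel m this ae]
    show "(\<lambda>q. d - q) ` ?R \<subseteq> ?R'" "?R' \<subseteq> insert 0 ((\<lambda>q. d - q) ` ?R)"
      unfolding rayleigh_lap by auto
  qed
  note neg = Inf_rayleigh_adj_neg[OF assms]
  have up: "q \<le> d - Inf ?R" if "q \<in> ?R'" for q
    using that sub(2) neg(1) cInf_lower[OF _ bdd_below_rayleigh_adj] by fastforce
  have "Sup ?R' \<le> d - Inf ?R" using up neg(2) sub(1) by (intro cSup_least) auto
  moreover have "d - Sup ?R' \<le> Inf ?R"
  proof (rule cInf_greatest[OF neg(2)])
    fix q assume "q \<in> ?R"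
    then have "d - q \<in> ?R'" using sub(1) by auto
    then have "d - q \<le> Sup ?R'" by (rule cSup_upper[OF _ bdd_aboveI[OF up]])
    then show "d - Sup ?R' \<le> q" by simp
  qed
  ultimately show ?thesis by (simp add: M_op_def)
qed

lemma hoffman_bound:
  assumes "1 \<le> d" "S \<in> sets (completion M)" "independent_set E S"
  shows "measure (completion M) S \<le> - m_op M (adj_op E) / (d - m_op M (adj_op E))"
proof -
  let ?m = "Inf (rayleigh_quotients M adj)"
  \<comment> \<open>A completion-measurable set has a Borel part of the same measure, and a subset
    of an independent set is independent.\<close>
  have S': "main_part M S \<in> sets borel" "independent_set E (main_part M S)"
    using main_part_sets[OF assms(2)] sets_M main_part_null_part_Un[OF assms(2)] assms(3)
    unfolding independent_set_def by blast+
  define s where "s = measure M (main_part M S)"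
  have s: "measure (completion M) S = s"
    using assms(2) by (simp add: s_def measure_def emeasure_completion)
  note neg = Inf_rayleigh_adj_neg(1)[OF assms(1)]
  have "s \<le> - ?m / (d - ?m)"
  proof (cases "s = 0")
    case True
    then show ?thesis using neg by (simp add: divide_nonpos_pos)
  next
    case False
    then have "s > 0" using measure_nonneg by (simp add: s_def less_le)
    have "s * (?m * (1 - s)) \<le> s * (- d * s)"
      using indep_measure(1)[OF S'] by (simp add: s_def[symmetric] power2_eq_square algebra_simps)
    then have "?m * (1 - s) \<le> - d * s" using \<open>s > 0\<close> by (rule mult_left_le_imp_le)
    then show ?thesis using neg by (simp add: field_simps)
  qed
  then show ?thesis by (simp add: s m_op_adj[OF assms(1)])
qed

end

theorem theorem6p2:
  fixes M :: "'a::polish_space measure" and E :: "'a \<Rightarrow> 'a \<Rightarrow> bool" and d :: nat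
    and S :: "'a set"
  assumes "prob_space M" and "sets M = sets borel"
    and "borel_graph E" and "regular_graph M E d" and "d \<ge> 1"
    and "pmp_graph M E"
    and "S \<in> sets (completion M)" and "independent_set E S"
  shows "measure (completion M) S \<le> - m_op M (adj_op E) / (real d - m_op M (adj_op E))
    \<and> - m_op M (adj_op E) / (real d - m_op M (adj_op E)) = 1 - real d / M_op M (lap_op E)
    \<and> indep_number M E \<le> - m_op M (adj_op E) / (real d - m_op M (adj_op E))"
proof -
  interpret prob_space M by fact
  have space: "space M = UNIV" using sets_eq_imp_space_eq[OF assms(2)] by simp
  \<comment> \<open>The exceptional degrees are enclosed in a Borel null set, whose complement
    serves as \<open>X\<close>.\<close>
  obtain N where N: "{x \<in> space M. \<not> (finite {y. E x y} \<and> card {y. E x y} = d)} \<subseteq> N"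
    "emeasure M N = 0" "N \<in> sets M"
    using assms(4) unfolding regular_graph_def by (rule AE_E)
  interpret regular_pmp_graph M E d "- N"
  proof
    show "- N \<in> sets borel" "- (- N) \<in> null_sets M" using N assms(2) by (auto simp: null_sets_def)
    show "finite {y. E x y} \<and> card {y. E x y} = d" if "x \<in> - N" for x using that N(1) space by auto
  qed (fact assms)+
  note m = m_op_adj[OF \<open>d \<ge> 1\<close>] and neg = Inf_rayleigh_adj_neg(1)[OF \<open>d \<ge> 1\<close>]
  have "- m_op M (adj_op E) / (real d - m_op M (adj_op E)) = 1 - real d / M_op M (lap_op E)"
    \<comment> \<open>The top of the Laplacian is \<open>d - m\<close>, which is positive because
      \<open>m\<close> is negative.\<close>
    using neg by (simp add: m M_op_lap[OF \<open>d \<ge> 1\<close>] field_simps)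
  moreover have "indep_number M E \<le> - m_op M (adj_op E) / (real d - m_op M (adj_op E))"
    unfolding indep_number_def
  proof (rule cSup_least)
    have "independent_set E {}" by (simp add: independent_set_def)
    then show "{measure (completion M) A |A. A \<in> sets (completion M) \<and> independent_set E A} \<noteq> {}"
      by (auto intro: sets.empty_sets)
  qed (use hoffman_bound[OF \<open>d \<ge> 1\<close>] in auto)
  ultimately show ?thesis using hoffman_bound[OF \<open>d \<ge> 1\<close> assms(7,8)] by blast
qed

end
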